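(* Let $\alpha\in(0,2)$, $a>0$, and let $\sigma:\mathbb{R}^2\times[0,\infty)\to\mathbb{R}$ be continuous and bounded. Let $U(y,t)$, $y\in\mathbb{R}^2$, $t\ge0$, be the random field defined by the LePage series \[ U(y,t)=C_\alpha\sum_{k\ge1}\Gamma_k^{-1/\alpha}\varphi(\xi_k)^{-1/\alpha}G(y,\xi_k,t)g_k \] (described in the context). Then for all $t\ge0$ and $x\in\mathbb{R}^2$ with $\sigma(x,t)\ne0$ and for all $\delta>0$, \[ \sup_{y\in B(x,\delta)}|U(y,t)|=+\infty\quad\text{almost surely}, \] where $B(x,\delta)=\{y:|y-x|\le\delta\}$.
   Context: Define, for $x,y\in\mathbb{R}^2$, $t\ge0$, \[ G(x,y,t)=\frac{1}{2\pi a}\int_0^{t-\frac{|x-y|}{a}}\frac{\sigma(y,\tau)}{\sqrt{a^2(t-\tau)^2-|y-x|^2}}\,d\tau\;\mathbf{1}_{\{|x-y|<at\}} \] (this may equal $+\infty$, e.g. when $y=x$). LePage construction: let $\varphi$ be a continuous, everywhere positive probability density on $\mathbb{R}^2$; let $\{\Gamma_k\}_{k\ge1}$ be the arrival times of a unit-intensity Poisson process, $\{\xi_k\}_{k\ge1}$ i.i.d. random vectors in $\mathbb{R}^2$ with density $\varphi$, and $\{g_k\}_{k\ge1}$ i.i.d. centered Gaussian variables with $E|g_k|^\alpha=1$, the three families being mutually independent; $C_\alpha=\big(\frac{\Gamma(2-\alpha)\cos(\pi\alpha/2)}{1-\alpha}\big)^{1/\alpha}$ is a positive constant. The S$\alpha$S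 random measure $M(A)=C_\alpha\sum_k\Gamma_k^{-1/\alpha}\varphi(\xi_k)^{-1/\alpha}\mathbf{1}_A(\xi_k)g_k$ is an independently scattered symmetric $\alpha$-stable measure with Lebesgue control measure, and $U(y,t)$ above is the corresponding version of $\iint G(y,z,t)M(dz)$ (for each fixed $(y,t)$ the series converges almost surely).
   Formalization: The claim is proved for t>0 rather than t≥0, since at t=0 the indicator makes G and U(·,0) vanish and the supremum is 0; at α=1, where the formula for C_α reads 0/0, its limit π/2 is used. *)

theory Defs
  imports "HOL-Probability.Probability"
begin

text \<open>The constant C_alpha; at alpha = 1 the formula is read as its limit pi/2.\<close>
definition C_alpha :: "real \<Rightarrow> real" where
  "C_alpha \<alpha> = (if \<alpha> = 1 then pi / 2
     else (Gamma (2 - \<alpha>) * cos (pi * \<alpha> / 2) / (1 - \<alpha>)) powr (1 / \<alpha>))"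

definition G_kernel :: "(real^2 \<Rightarrow> real \<Rightarrow> real) \<Rightarrow> real \<Rightarrow> real^2 \<Rightarrow> real^2 \<Rightarrow> real \<Rightarrow> real \<Rightarrow> real" where
  "G_kernel \<sigma> a x y t \<tau> = \<sigma> y \<tau> / sqrt (a\<^sup>2 * (t - \<tau>)\<^sup>2 - (norm (y - x))\<^sup>2)"

definition G_finite :: "(real^2 \<Rightarrow> real \<Rightarrow> real) \<Rightarrow> real \<Rightarrow> real^2 \<Rightarrow> real^2 \<Rightarrow> real \<Rightarrow> bool" where
  "G_finite \<sigma> a x y t \<longleftrightarrow> \<not> (norm (x - y) < a * t) \<or>
     set_integrable lborel {0..t - norm (x - y) / a} (G_kernel \<sigma> a x y t)"

text \<open>Value of G(x,y,t) (meaningful where G_finite holds).\<close>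
definition G_fun :: "(real^2 \<Rightarrow> real \<Rightarrow> real) \<Rightarrow> real \<Rightarrow> real^2 \<Rightarrow> real^2 \<Rightarrow> real \<Rightarrow> real" where
  "G_fun \<sigma> a x y t = (if norm (x - y) < a * t
     then 1 / (2 * pi * a) * (LINT \<tau>:{0..t - norm (x - y) / a}|lborel. G_kernel \<sigma> a x y t \<tau>)
     else 0)"

text \<open>Poisson arrival times: Gamma_k = E_1 + ... + E_k with i.i.d. Exp(1) interarrival
  times; index k :: nat stands for the (k+1)-th arrival.\<close>
definition arrival :: "(nat \<Rightarrow> 'a \<Rightarrow> real) \<Rightarrow> nat \<Rightarrow> 'a \<Rightarrow> real" where
  "arrival E k \<omega> = (\<Sum>i\<le>k. E i \<omega>)"

definition lepage_term :: "real \<Rightarrow> real \<Rightarrow> (real^2 \<Rightarrow> real \<Rightarrow> real) \<Rightarrow> (real^2 \<Rightarrow> real)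
    \<Rightarrow> (nat \<Rightarrow> 'a \<Rightarrow> real) \<Rightarrow> (nat \<Rightarrow> 'a \<Rightarrow> real^2) \<Rightarrow> (nat \<Rightarrow> 'a \<Rightarrow> real)
    \<Rightarrow> real^2 \<Rightarrow> real \<Rightarrow> 'a \<Rightarrow> nat \<Rightarrow> real" where
  "lepage_term \<alpha> a \<sigma> \<phi> E \<xi> g y t \<omega> k =
     C_alpha \<alpha> * arrival E k \<omega> powr (-1 / \<alpha>) * \<phi> (\<xi> k \<omega>) powr (-1 / \<alpha>)
       * G_fun \<sigma> a y (\<xi> k \<omega>) t * g k \<omega>"

definition U_defined where
  "U_defined \<alpha> a \<sigma> \<phi> E \<xi> g y t \<omega> \<longleftrightarrow>
     (\<forall>k. G_finite \<sigma> a y (\<xi> k \<omega>) t) \<and> summable (lepage_term \<alpha> a \<sigma> \<phi> E \<xi> g y t \<omega>)"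

definition U_field where
  "U_field \<alpha> a \<sigma> \<phi> E \<xi> g y t \<omega> = suminf (lepage_term \<alpha> a \<sigma> \<phi> E \<xi> g y t \<omega>)"

text \<open>Mutual independence of the three families (indep_vars unfolded, since the
  families have different codomains).\<close>
definition lepage_indep :: "'a measure \<Rightarrow> (nat \<Rightarrow> 'a \<Rightarrow> real) \<Rightarrow> (nat \<Rightarrow> 'a \<Rightarrow> real^2)
    \<Rightarrow> (nat \<Rightarrow> 'a \<Rightarrow> real) \<Rightarrow> bool" where
  "lepage_indep M E \<xi> g \<longleftrightarrow> prob_space.indep_sets M
     (\<lambda>i. case i of
        Inl n \<Rightarrow> {E n -` A \<inter> space M | A. A \<in> sets borel}
      | Inr (Inl n) \<Rightarrow> {\<xi> n -` A \<inter> space M | A. A \<in> sets borel}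
      | Inr (Inr n) \<Rightarrow> {g n -` A \<inter> space M | A. A \<in> sets borel})
     (UNIV :: (nat + nat + nat) set)"

end

theory Submission
  imports Defs
begin

text \<open>
  For fixed \<open>y\<close> the kernel \<open>G(y, z, t)\<close> is bounded by a multiple of \<open>1 / sqrt |y - z|\<close> and vanishes for
  \<open>|y - z| \<ge> at\<close>, so \<open>\<phi>(\<xi>) powr (-1/\<alpha>) * G(y, \<xi>, t)\<close> is square integrable. As the arrival times grow
  linearly and \<open>2/\<alpha> > 1\<close>, Kolmogorov's convergence theorem (the Gaussian factors are centred and
  independent of everything else) shows that the series defining \<open>U(y, t)\<close> converges almost surely;
  hence almost surely it converges on a whole countable dense set \<open>D\<close>.

  Almost surely some \<open>\<xi>\<^sub>k\<close> lies close to \<open>x\<close>. On \<open>D\<close> write \<open>U(y, t) = T(y) g\<^sub>k + R(y)\<close>, where neither \<open>T\<close> nor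
  \<open>R\<close> involves \<open>g\<^sub>k\<close>. Since \<open>G(y, z, t)\<close> has a logarithmic singularity at \<open>y = z\<close> with coefficient
  proportional to \<open>\<sigma>(z, t)\<close>, \<open>T\<close> is unbounded on \<open>D\<close> near \<open>\<xi>\<^sub>k\<close>. Therefore \<open>u T + R\<close> is bounded on \<open>D\<close> for
  at most one real \<open>u\<close>, and by Fubini \<open>g\<^sub>k\<close>, having no atoms, avoids that value almost surely.
\<close>

section \<open>Kolmogorov's convergence theorem\<close>

text \<open>Stopping keeps the increments orthogonal, so Chebyshev's inequality for the stopped sum controls the
  maximum of the partial sums.\<close>
primrec stopped_sum :: "real \<Rightarrow> (nat \<Rightarrow> 'a \<Rightarrow> real) \<Rightarrow> nat \<Rightarrow> 'a \<Rightarrow> real" where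
  "stopped_sum e X 0 = (\<lambda>_. 0)"
| "stopped_sum e X (Suc n) = (\<lambda>w. stopped_sum e X n w +
     X n w * (if \<bar>stopped_sum e X n w\<bar> < e then 1 else 0))"

text \<open>The stopped sum freezes once it reaches level \<open>e\<close>: before that it is the
  ordinary partial sum, afterwards it never drops below \<open>e\<close> in absolute value.\<close>

lemma stopped_sum_cases:
  assumes "0 < e"
  shows "stopped_sum e X n w = (\<Sum>i<n. X i w) \<and> (\<forall>k\<le>n. \<bar>\<Sum>i<k. X i w\<bar> < e)
    \<or> e \<le> \<bar>stopped_sum e X n w\<bar>"
proof (induction n)
  case 0
  then show ?case using assms by simp
next
  case (Suc n)
  then show ?case
    by (auto simp: le_Suc_eq not_less)
qed

lemma stopped_sum_measurable:
  assumes "\<And>i. i < n \<Longrightarrow> X i \<in> borel_measurable N"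
  shows "stopped_sum e X n \<in> borel_measurable N"
  using assms
proof (induction n)
  case (Suc n)
  then have [measurable]: "stopped_sum e X n \<in> borel_measurable N" "X n \<in> borel_measurable N"
    by auto
  show ?case by simp
qed simp

lemma (in prob_space) integrable_of_square_integrable:
  fixes f :: "'a \<Rightarrow> real"
  assumes "f \<in> borel_measurable M" "integrable M (\<lambda>w. (f w)\<^sup>2)"
  shows "integrable M f"
  using square_integrable_imp_integrable[OF assms(1)] assms(2) by simp

text \<open>When the square is expanded, the cross term vanishes by \<open>orth\<close> and the
  cutoff can only decrease the new square. \<open>F n\<close> is asked only to make the earlier
  terms measurable, so that it can later be the sigma-algebra of everything except
  \<open>g n\<close>; these do not increase with \<open>n\<close>.\<close>

lemma (in prob_space) stopped_sum_second_moment: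
  fixes X :: "nat \<Rightarrow> 'a \<Rightarrow> real"
  assumes sub: "\<And>n. subalgebra M (F n)"
    and adapted: "\<And>i n. i < n \<Longrightarrow> X i \<in> borel_measurable (F n)"
    and rv [measurable]: "\<And>n. X n \<in> borel_measurable M"
    and sq: "\<And>n. integrable M (\<lambda>w. (X n w)\<^sup>2)"
    and orth: "\<And>n Z c. Z \<in> borel_measurable (F n) \<Longrightarrow> (\<And>w. \<bar>Z w\<bar> \<le> c)
      \<Longrightarrow> expectation (\<lambda>w. X n w * Z w) = 0"
  shows "integrable M (\<lambda>w. (stopped_sum e X n w)\<^sup>2) \<and>
    expectation (\<lambda>w. (stopped_sum e X n w)\<^sup>2) \<le> (\<Sum>i<n. expectation (\<lambda>w. (X i w)\<^sup>2))"
proof (induction n)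
  case 0
  then show ?case by simp
next
  case (Suc n)
  let ?S = "stopped_sum e X n"
  let ?I = "\<lambda>w. if \<bar>?S w\<bar> < e then 1 else 0 :: real"
  have SF [measurable]: "?S \<in> borel_measurable (F n)"
    by (rule stopped_sum_measurable) (rule adapted)
  have SM [measurable]: "?S \<in> borel_measurable M"
    by (rule measurable_from_subalg[OF sub SF])
  have eq: "(stopped_sum e X (Suc n) w)\<^sup>2 = (?S w)\<^sup>2 + 2 * (X n w * (?S w * ?I w)) + (X n w)\<^sup>2 * ?I w" for w
    by (simp add: power2_eq_square algebra_simps)
  \<comment> \<open>The cutoff bounds the factor multiplying \<open>X n\<close>, as
    \<open>orth\<close> requires; the absolute value covers negative \<open>e\<close>.\<close>
  have bdd: "\<bar>?S w * ?I w\<bar> \<le> \<bar>e\<bar>" for w by auto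
  have o: "expectation (\<lambda>w. X n w * (?S w * ?I w)) = 0"
    by (rule orth[OF _ bdd]) measurable
  have intX: "integrable M (X n)"
    by (rule integrable_of_square_integrable[OF rv sq])
  have i1: "integrable M (\<lambda>w. X n w * (?S w * ?I w))"
  proof (rule Bochner_Integration.integrable_bound)
    show "integrable M (\<lambda>w. \<bar>e\<bar> * X n w)" using intX by simp
    show "AE w in M. norm (X n w * (?S w * ?I w)) \<le> norm (\<bar>e\<bar> * X n w)"
    proof (intro AE_I2)
      fix w show "norm (X n w * (?S w * ?I w)) \<le> norm (\<bar>e\<bar> * X n w)"
        using mult_left_mono[OF bdd[of w], of "\<bar>X n w\<bar>"] by (simp add: abs_mult mult.commute)
    qed
  qed measurable
  have i2: "integrable M (\<lambda>w. (X n w)\<^sup>2 * ?I w)"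
    by (rule Bochner_Integration.integrable_bound[OF sq[of n]]) auto
  have le: "expectation (\<lambda>w. (X n w)\<^sup>2 * ?I w) \<le> expectation (\<lambda>w. (X n w)\<^sup>2)"
    by (rule integral_mono[OF i2 sq]) auto
  have "integrable M (\<lambda>w. (stopped_sum e X (Suc n) w)\<^sup>2)"
    unfolding eq using Suc.IH i1 i2 by (intro Bochner_Integration.integrable_add) auto
  moreover have "expectation (\<lambda>w. (stopped_sum e X (Suc n) w)\<^sup>2) =
      expectation (\<lambda>w. (?S w)\<^sup>2) + expectation (\<lambda>w. (X n w)\<^sup>2 * ?I w)"
    unfolding eq using Suc.IH i1 i2 o by simp
  ultimately show ?case using Suc.IH le by simp
qed

text \<open>Chebyshev's inequality for the stopped sum suffices: a partial sum of size
  \<open>e\<close> at any time up to \<open>n\<close> leaves the stopped sum at size at least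
  \<open>e\<close> at time \<open>n\<close>.\<close>

lemma (in prob_space) kolmogorov_maximal_inequality:
  fixes X :: "nat \<Rightarrow> 'a \<Rightarrow> real"
  assumes sub: "\<And>n. subalgebra M (F n)"
    and adapted: "\<And>i n. i < n \<Longrightarrow> X i \<in> borel_measurable (F n)"
    and rv [measurable]: "\<And>n. X n \<in> borel_measurable M"
    and sq: "\<And>n. integrable M (\<lambda>w. (X n w)\<^sup>2)"
    and orth: "\<And>n Z c. Z \<in> borel_measurable (F n) \<Longrightarrow> (\<And>w. \<bar>Z w\<bar> \<le> c)
      \<Longrightarrow> expectation (\<lambda>w. X n w * Z w) = 0"
    and e: "0 < e"
  shows "prob {w \<in> space M. \<exists>k\<le>n. e \<le> \<bar>\<Sum>i<k. X i w\<bar>} \<le> (\<Sum>i<n. expectation (\<lambda>w. (X i w)\<^sup>2)) / e\<^sup>2"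
proof -
  let ?S = "stopped_sum e X n"
  have [measurable]: "?S \<in> borel_measurable M"
    by (rule stopped_sum_measurable) (rule rv)
  have S2: "integrable M (\<lambda>w. (?S w)\<^sup>2) \<and>
    expectation (\<lambda>w. (?S w)\<^sup>2) \<le> (\<Sum>i<n. expectation (\<lambda>w. (X i w)\<^sup>2))"
  proof (rule stopped_sum_second_moment[where F=F])
    fix n Z c assume "Z \<in> borel_measurable (F n)" "\<And>w. \<bar>Z w\<bar> \<le> (c :: real)"
    then show "expectation (\<lambda>w. X n w * Z w) = 0" by (rule orth)
  qed (fact sub adapted rv sq)+
  have "prob {w \<in> space M. \<exists>k\<le>n. e \<le> \<bar>\<Sum>i<k. X i w\<bar>} \<le> prob {w \<in> space M. e\<^sup>2 \<le> (?S w)\<^sup>2}"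
  proof (rule finite_measure_mono)
    show "{w \<in> space M. \<exists>k\<le>n. e \<le> \<bar>\<Sum>i<k. X i w\<bar>} \<subseteq> {w \<in> space M. e\<^sup>2 \<le> (?S w)\<^sup>2}"
    proof safe
      fix w k assume "k \<le> n" "e \<le> \<bar>\<Sum>i<k. X i w\<bar>"
      then have "e \<le> \<bar>?S w\<bar>"
        using stopped_sum_cases[OF e, of X n w] by auto
      then show "e\<^sup>2 \<le> (?S w)\<^sup>2"
        using e by (metis abs_of_pos abs_le_square_iff)
    qed
  qed measurable
  also have "\<dots> \<le> expectation (\<lambda>w. (?S w)\<^sup>2) / e\<^sup>2"
    by (rule integral_Markov_inequality_measure[where A="{}"]) (use S2 e in auto)
  also have "\<dots> \<le> (\<Sum>i<n. expectation (\<lambda>w. (X i w)\<^sup>2)) / e\<^sup>2"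
    using S2 e by (intro divide_right_mono) auto
  finally show ?thesis .
qed

text \<open>The maximal inequality on the block after \<open>m\<close> bounds the probability of a
  large oscillation by a tail of the convergent series of second moments, so the partial sums are
  almost surely Cauchy.\<close>

lemma (in prob_space) AE_summable_of_orthogonal:
  fixes X :: "nat \<Rightarrow> 'a \<Rightarrow> real"
  assumes sub: "\<And>n. subalgebra M (F n)"
    and adapted: "\<And>i n. i < n \<Longrightarrow> X i \<in> borel_measurable (F n)"
    and rv [measurable]: "\<And>n. X n \<in> borel_measurable M"
    and sq: "\<And>n. integrable M (\<lambda>w. (X n w)\<^sup>2)"
    and orth: "\<And>n Z c. Z \<in> borel_measurable (F n) \<Longrightarrow> (\<And>w. \<bar>Z w\<bar> \<le> c)
      \<Longrightarrow> expectation (\<lambda>w. X n w * Z w) = 0"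
    and summ: "summable (\<lambda>n. expectation (\<lambda>w. (X n w)\<^sup>2))"
  shows "AE w in M. summable (\<lambda>n. X n w)"
proof -
  let ?V = "\<lambda>n. expectation (\<lambda>w. (X n w)\<^sup>2)"
  have block: "prob {w \<in> space M. \<exists>k\<le>n. e \<le> \<bar>\<Sum>i<k. X (m + i) w\<bar>} \<le> (\<Sum>i. ?V (m + i)) / e\<^sup>2"
    if "0 < e" for e n m
  proof -
    have "prob {w \<in> space M. \<exists>k\<le>n. e \<le> \<bar>\<Sum>i<k. X (m + i) w\<bar>} \<le> (\<Sum>i<n. ?V (m + i)) / e\<^sup>2"
      by (rule kolmogorov_maximal_inequality[where F="\<lambda>i. F (m + i)"]) (use sub adapted sq that in \<open>auto intro: orth\<close>)
    also have "\<dots> \<le> (\<Sum>i. ?V (m + i)) / e\<^sup>2"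
      using summable_ignore_initial_segment[OF summ, of m]
      by (intro divide_right_mono sum_le_suminf) (auto simp: add.commute)
    finally show ?thesis .
  qed
  \<comment> \<open>Passes from finite blocks to infinite ones by continuity of the measure along
    the increasing events \<open>?B n\<close>.\<close>
  have tail: "prob {w \<in> space M. \<exists>k. e \<le> \<bar>\<Sum>i<k. X (m + i) w\<bar>} \<le> (\<Sum>i. ?V (m + i)) / e\<^sup>2"
    if e: "0 < e" for e m
  proof (rule LIMSEQ_le_const2)
    let ?B = "\<lambda>n. {w \<in> space M. \<exists>k\<le>n. e \<le> \<bar>\<Sum>i<k. X (m + i) w\<bar>}"
    have "(\<lambda>n. prob (?B n)) \<longlonglongrightarrow> prob (\<Union>n. ?B n)"
      by (rule finite_Lim_measure_incseq) (auto simp: incseq_def intro: order_trans)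
    also have "(\<Union>n. ?B n) = {w \<in> space M. \<exists>k. e \<le> \<bar>\<Sum>i<k. X (m + i) w\<bar>}"
      by auto
    finally show "(\<lambda>n. prob (?B n)) \<longlonglongrightarrow> prob {w \<in> space M. \<exists>k. e \<le> \<bar>\<Sum>i<k. X (m + i) w\<bar>}" .
  qed (use block[OF e] in auto)
  have lim: "(\<lambda>m. (\<Sum>i. ?V (m + i)) / e\<^sup>2) \<longlonglongrightarrow> 0" for e
    using suminf_exist_split2[OF summ] tendsto_divide_0 by (fastforce simp: add.commute intro: tendsto_divide_zero)
  have null: "AE w in M. \<exists>m. \<forall>k. \<bar>\<Sum>i<k. X (m + i) w\<bar> < e" if e: "0 < e" for e
  proof -
    \<comment> \<open>The exceptional set lies in the tail event of every \<open>m\<close>, and the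
      bounds for these tend to 0.\<close>
    let ?N = "{w \<in> space M. \<forall>m. \<exists>k. e \<le> \<bar>\<Sum>i<k. X (m + i) w\<bar>}"
    have "prob ?N \<le> (\<Sum>i. ?V (m + i)) / e\<^sup>2" for m
      by (rule order_trans[OF finite_measure_mono tail[OF e]]) auto
    then have "prob ?N \<le> 0"
      by (intro LIMSEQ_le_const[OF lim]) auto
    then have "prob ?N = 0"
      using measure_nonneg[of M ?N] by linarith
    then have "AE w in M. \<not> (\<forall>m. \<exists>k. e \<le> \<bar>\<Sum>i<k. X (m + i) w\<bar>)"
      by (subst (asm) prob_eq_0) auto
    then show ?thesis by (auto simp: not_le)
  qed
  have "AE w in M. \<forall>j. \<exists>m. \<forall>k. \<bar>\<Sum>i<k. X (m + i) w\<bar> < inverse (real (Suc j))"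
    by (subst AE_all_countable) (intro allI null, simp)
  then show ?thesis
  proof eventually_elim
    case (elim w)
    show ?case
    proof (rule Cauchy_convergent[THEN summable_iff_convergent[THEN iffD2]], rule metric_CauchyI)
      fix r :: real assume "0 < r"
      then obtain j where j: "inverse (real (Suc j)) < r / 2"
        using reals_Archimedean[of "r / 2"] by auto
      obtain m where m: "\<And>k. \<bar>\<Sum>i<k. X (m + i) w\<bar> < r / 2"
        using elim[rule_format, of j] j less_trans by blast
      have split: "(\<Sum>i<p. X i w) = (\<Sum>i<m. X i w) + (\<Sum>i<p - m. X (m + i) w)" if "m \<le> p" for p
      proof -
        have "(\<Sum>i<m + k. X i w) = (\<Sum>i<m. X i w) + (\<Sum>i<k. X (m + i) w)" for k
          by (induction k) auto
        from this[of "p - m"] that show ?thesis by simp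
      qed
      show "\<exists>K. \<forall>p\<ge>K. \<forall>q\<ge>K. dist (\<Sum>i<p. X i w) (\<Sum>i<q. X i w) < r"
      proof (intro exI allI impI)
        fix p q assume "m \<le> p" "m \<le> q"
        then show "dist (\<Sum>i<p. X i w) (\<Sum>i<q. X i w) < r"
          using m[of "p - m"] m[of "q - m"] split[of p] split[of q] unfolding dist_real_def by linarith
      qed
    qed
  qed
qed

section \<open>The wave kernel\<close>

text \<open>\<open>?F\<close> is an antiderivative. The integrand is unbounded at the right
  endpoint, so the fundamental theorem is used in the form that asks for derivatives only in the
  open interval.\<close>

lemma has_bochner_integral_inverse_sqrt:
  fixes a r t :: real
  assumes a: "0 < a" and r: "r < a * t"
  shows "has_bochner_integral lborel (\<lambda>\<tau>. indicator {0..t - r / a} \<tau> * (1 / sqrt (a * (t - \<tau>) - r)))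
    (2 / a * sqrt (a * t - r))"
proof -
  let ?s = "t - r / a"
  let ?F = "\<lambda>\<tau>. - (2 / a) * sqrt (a * (t - \<tau>) - r)"
  let ?f = "\<lambda>\<tau>. 1 / sqrt (a * (t - \<tau>) - r)"
  have s: "0 \<le> ?s" using a r by (simp add: field_simps)
  have nn: "0 \<le> a * (t - \<tau>) - r" if "\<tau> \<le> ?s" for \<tau>
    using a that by (simp add: field_simps)
  have "(?f has_integral (?F ?s - ?F 0)) {0..?s}"
  proof (rule fundamental_theorem_of_calculus_interior[OF s])
    show "continuous_on {0..?s} ?F" by (intro continuous_intros)
    fix \<tau> assume "\<tau> \<in> {0<..<?s}"
    then have "0 < a * (t - \<tau>) - r" using a by (simp add: field_simps)
    then show "(?F has_vector_derivative ?f \<tau>) (at \<tau>)"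
      unfolding has_real_derivative_iff_has_vector_derivative[symmetric]
      using a by (auto intro!: derivative_eq_intros simp: field_simps)
  qed
  moreover have fun_eq: "(\<lambda>\<tau>. indicator {0..?s} \<tau> * ?f \<tau>) = (\<lambda>\<tau>. if \<tau> \<in> {0..?s} then ?f \<tau> else 0)"
    by (auto simp: indicator_def)
  moreover have "?F ?s - ?F 0 = 2 / a * sqrt (a * t - r)"
    using a by (simp add: field_simps)
  ultimately have "((\<lambda>\<tau>. indicator {0..?s} \<tau> * ?f \<tau>) has_integral (2 / a * sqrt (a * t - r))) UNIV"
    unfolding fun_eq by (simp only: has_integral_restrict_UNIV)
  then have "(\<integral>\<^sup>+ \<tau>. ennreal (indicator {0..?s} \<tau> * ?f \<tau>) \<partial>lborel) = ennreal (2 / a * sqrt (a * t - r))"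
    using nn by (intro nn_integral_has_integral_lborel) (auto split: split_indicator)
  then show ?thesis
    by (intro has_bochner_integral_nn_integral) (use a r nn in \<open>auto split: split_indicator\<close>)
qed

text \<open>Where \<open>norm (y - z)\<close> lies between \<open>R / 2 ^ Suc n\<close> and
  \<open>R / 2 ^ n\<close>, the integrand is at most \<open>2 ^ Suc n / R\<close>, while the ball of
  radius \<open>R / 2 ^ n\<close> has area of order \<open>1 / 4 ^ n\<close>. Summing over
  \<open>n\<close> gives a geometric series.\<close>

lemma nn_integral_inverse_norm_ball:
  fixes y :: "real^2"
  assumes R: "0 < R"
  shows "(\<integral>\<^sup>+ z. ennreal (1 / norm (y - z)) * indicator (ball y R) z \<partial>lborel) < \<infinity>"
proof -
  let ?c = "\<lambda>n. 2 ^ Suc n / R"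
  let ?B = "\<lambda>n. ball y (R / 2 ^ n)"
  have le: "ennreal (1 / norm (y - z)) * indicator (ball y R) z
      \<le> (\<Sum>n. ennreal (?c n) * indicator (?B n) z)" for z
  proof (cases "z \<in> ball y R \<and> z \<noteq> y")
    case True
    define d where "d = norm (y - z)"
    have d: "0 < d" "d < R" using True by (auto simp: d_def dist_norm)
    \<comment> \<open>The least such \<open>n\<close> names the dyadic ring containing
      \<open>z\<close>: \<open>n1\<close> is its inner and \<open>n2\<close> its outer
      bound.\<close>
    define n where "n = (LEAST n. R / 2 ^ Suc n \<le> d)"
    have "\<exists>n. R / 2 ^ Suc n \<le> d"
    proof -
      obtain n where "R / d < 2 ^ n" using real_arch_pow[of 2 "R / d"] by auto
      then have "R / 2 ^ Suc n \<le> d" using d R by (simp add: field_simps)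
      then show ?thesis by blast
    qed
    then have n1: "R / 2 ^ Suc n \<le> d" unfolding n_def by (rule LeastI_ex)
    have n2: "d < R / 2 ^ n"
    proof (cases n)
      case 0
      then show ?thesis using d by simp
    next
      case (Suc m)
      then have "\<not> R / 2 ^ Suc m \<le> d" using not_less_Least[of m "\<lambda>n. R / 2 ^ Suc n \<le> d"] by (simp add: n_def)
      then show ?thesis using Suc by simp
    qed
    have "1 / d \<le> ?c n" using n1 d R by (simp add: field_simps)
    then have "ennreal (1 / norm (y - z)) * indicator (ball y R) z \<le> ennreal (?c n) * indicator (?B n) z"
      using True n2 by (auto simp: d_def dist_norm intro!: ennreal_leI)
    also have "\<dots> \<le> (\<Sum>n. ennreal (?c n) * indicator (?B n) z)"
      using sum_le_suminf[of "\<lambda>n. ennreal (?c n) * indicator (?B n) z" "{n}"]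
      by (simp del: sum_mult_indicator)
    finally show ?thesis .
  qed auto
  have B: "emeasure lborel (?B n) = ennreal (pi * (R / 2 ^ n)\<^sup>2)" for n
    using R by (simp add: emeasure_ball unit_ball_vol_2)
  have "(\<integral>\<^sup>+ z. ennreal (1 / norm (y - z)) * indicator (ball y R) z \<partial>lborel)
      \<le> (\<integral>\<^sup>+ z. (\<Sum>n. ennreal (?c n) * indicator (?B n) z) \<partial>lborel)"
    by (rule nn_integral_mono) (rule le)
  also have "\<dots> = (\<Sum>n. \<integral>\<^sup>+ z. ennreal (?c n) * indicator (?B n) z \<partial>lborel)"
    by (rule nn_integral_suminf) (auto intro!: borel_measurable_times_ennreal borel_measurable_indicator)
  also have "\<dots> = (\<Sum>n. ennreal (2 * pi * R * (1 / 2) ^ n))"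
  proof (intro suminf_cong)
    fix n
    have "(\<integral>\<^sup>+ z. ennreal (?c n) * indicator (?B n) z \<partial>lborel) = ennreal (?c n) * ennreal (pi * (R / 2 ^ n)\<^sup>2)"
      by (subst nn_integral_cmult_indicator) (auto simp: B)
    also have "\<dots> = ennreal (?c n * (pi * (R / 2 ^ n)\<^sup>2))"
      using R by (intro ennreal_mult[symmetric]) auto
    also have "?c n * (pi * (R / 2 ^ n)\<^sup>2) = 2 * pi * R * (1 / 2) ^ n"
      using R by (simp add: field_simps power2_eq_square)
    finally show "(\<integral>\<^sup>+ z. ennreal (?c n) * indicator (?B n) z \<partial>lborel) = ennreal (2 * pi * R * (1 / 2) ^ n)" .
  qed
  also have "\<dots> = ennreal (\<Sum>n. 2 * pi * R * (1 / 2) ^ n)"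
    by (rule suminf_ennreal2) (use R in \<open>auto intro!: summable_mult summable_geometric\<close>)
  also have "\<dots> < \<infinity>" by simp
  finally show ?thesis .
qed

section \<open>Measurability, size and singularity of the kernel\<close>

locale wave_kernel =
  fixes a t B :: real and \<sigma> :: "real^2 \<Rightarrow> real \<Rightarrow> real"
  assumes a_pos: "0 < a" and t_pos: "0 < t"
    and cont: "continuous_on (UNIV \<times> {0..}) (\<lambda>(y, \<tau>). \<sigma> y \<tau>)"
    and bound: "\<And>y \<tau>. 0 \<le> \<tau> \<Longrightarrow> \<bar>\<sigma> y \<tau>\<bar> \<le> B"
begin

lemma B_nonneg: "0 \<le> B"
  using bound[of 0 0] by simp

text \<open>Continuity is given only for nonnegative times; truncation yields a Borel function on
  the whole product.\<close>

lemma sigma_measurable: "(\<lambda>(z, \<tau>). indicator {0..} \<tau> * \<sigma> z \<tau>) \<in> borel_measurable (borel \<Otimes>\<^sub>M borel)"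
proof -
  have "(\<lambda>p. indicator (UNIV \<times> {0..}) p *\<^sub>R (case p of (z, \<tau>) \<Rightarrow> \<sigma> z \<tau>)) \<in> borel_measurable borel"
    by (rule borel_measurable_continuous_on_indicator[OF _ cont])
      (auto intro!: borel_closed closed_Times)
  then show ?thesis
    unfolding borel_prod by (rule measurable_cong[THEN iffD1, rotated]) (auto simp: indicator_def)
qed

lemma sigma_measurable' [measurable (raw)]:
  assumes "f \<in> borel_measurable N" "h \<in> borel_measurable N"
  shows "(\<lambda>w. indicator {0..} (h w) * \<sigma> (f w) (h w)) \<in> borel_measurable N"
  using measurable_compose[OF measurable_Pair[OF assms] sigma_measurable] by simp

text \<open>The second indicator is implied by the first. It is inserted so that \<sigma> enters
  only through its truncated, Borel measurable version.\<close>

lemma kernel_restrict: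
  "indicator {0..s} \<tau> *\<^sub>R G_kernel \<sigma> a y z t \<tau> =
    indicator {0..s} \<tau> * ((indicator {0..} \<tau> * \<sigma> z \<tau>) / sqrt (a\<^sup>2 * (t - \<tau>)\<^sup>2 - (norm (z - y))\<^sup>2))"
  by (auto simp: G_kernel_def split: split_indicator)

text \<open>The integrand is jointly measurable in \<open>z\<close> and \<open>\<tau>\<close>,
  including the indicator of the interval whose endpoint moves with \<open>z\<close>; integrating
  out \<open>\<tau>\<close> preserves measurability.\<close>

lemma G_fun_measurable: "(\<lambda>z. G_fun \<sigma> a y z t) \<in> borel_measurable borel"
proof -
  have "(\<lambda>z. LINT \<tau>|lborel. indicator {0..t - norm (y - z) / a} \<tau> *
      ((indicator {0..} \<tau> * \<sigma> z \<tau>) / sqrt (a\<^sup>2 * (t - \<tau>)\<^sup>2 - (norm (z - y))\<^sup>2))) \<in> borel_measurable borel"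
  proof (rule lborel.borel_measurable_lebesgue_integral)
    have [measurable]: "(\<lambda>w. indicator {0..t - norm (y - fst w) / a} (snd w) :: real)
        \<in> borel_measurable (borel \<Otimes>\<^sub>M lborel)"
      unfolding indicator_def atLeastAtMost_iff by measurable
    show "(\<lambda>(z, \<tau>). indicator {0..t - norm (y - z) / a} \<tau> *
      ((indicator {0..} \<tau> * \<sigma> z \<tau>) / sqrt (a\<^sup>2 * (t - \<tau>)\<^sup>2 - (norm (z - y))\<^sup>2)))
      \<in> borel_measurable (borel \<Otimes>\<^sub>M lborel)"
      unfolding split_beta by measurable
  qed
  then show ?thesis
    unfolding G_fun_def set_lebesgue_integral_def kernel_restrict by measurable
qed

text \<open>The difference of squares factors, and the factor \<open>a * (t - \<tau>) + r\<close> is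
  at least \<open>r\<close>.\<close>

lemma kernel_sqrt_bound:
  assumes "0 < r" "\<tau> \<le> t - r / a"
  shows "sqrt r * sqrt (a * (t - \<tau>) - r) \<le> sqrt (a\<^sup>2 * (t - \<tau>)\<^sup>2 - r\<^sup>2)"
proof -
  have nn: "0 \<le> a * (t - \<tau>) - r" using assms a_pos by (simp add: field_simps)
  have "r * (a * (t - \<tau>) - r) \<le> (a * (t - \<tau>) + r) * (a * (t - \<tau>) - r)"
    using assms nn by (intro mult_right_mono) auto
  also have "\<dots> = a\<^sup>2 * (t - \<tau>)\<^sup>2 - r\<^sup>2" by (simp add: power2_eq_square algebra_simps)
  finally show ?thesis by (simp add: real_sqrt_mult[symmetric])
qed

lemma kernel_bound:
  assumes z: "z \<noteq> y"
  shows "\<bar>indicator {0..t - norm (y - z) / a} \<tau> *\<^sub>R G_kernel \<sigma> a y z t \<tau>\<bar> \<le>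
    B / sqrt (norm (y - z)) * (indicator {0..t - norm (y - z) / a} \<tau> * (1 / sqrt (a * (t - \<tau>) - norm (y - z))))"
proof (cases "\<tau> \<in> {0..t - norm (y - z) / a}")
  case True
  let ?r = "norm (y - z)"
  let ?q = "sqrt (a\<^sup>2 * (t - \<tau>)\<^sup>2 - ?r\<^sup>2)"
  let ?p = "sqrt ?r * sqrt (a * (t - \<tau>) - ?r)"
  have r: "0 < ?r" using z by simp
  have nn: "0 \<le> a * (t - \<tau>) - ?r" using True a_pos by (simp add: field_simps)
  have le: "?p \<le> ?q" using kernel_sqrt_bound[OF r] True by simp
  have "\<bar>\<sigma> z \<tau>\<bar> / ?q \<le> B / ?p"
  \<comment> \<open>This happens at the upper end of the interval, where both denominators are 0 and
    both quotients are therefore 0 by convention.\<close>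
  proof (cases "?p = 0")
    case True
    then have "a * (t - \<tau>) = ?r" using r by auto
    then have "a\<^sup>2 * (t - \<tau>)\<^sup>2 = ?r\<^sup>2" by (metis power_mult_distrib)
    then have "\<bar>\<sigma> z \<tau>\<bar> / ?q = 0" by simp
    then show ?thesis by (simp only: True div_by_0)
  next
    case False
    then have "0 < ?p" using nn r by (simp add: less_le)
    then show ?thesis using bound[of \<tau> z] True le by (intro frac_le) auto
  qed
  then show ?thesis using True le nn
    by (simp add: G_kernel_def norm_minus_commute[of z y] abs_divide abs_of_nonneg[OF order_trans[OF _ le]])
qed simp

lemma kernel_integrable:
  assumes "z \<noteq> y" "norm (y - z) < a * t"
  shows "set_integrable lborel {0..t - norm (y - z) / a} (G_kernel \<sigma> a y z t)"
  unfolding set_integrable_def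
proof (rule Bochner_Integration.integrable_bound)
  let ?f = "\<lambda>\<tau>. B / sqrt (norm (y - z)) * (indicator {0..t - norm (y - z) / a} \<tau> * (1 / sqrt (a * (t - \<tau>) - norm (y - z))))"
  show "integrable lborel ?f"
    using has_bochner_integral_inverse_sqrt[OF a_pos assms(2)]
    by (intro integrable_mult_right) (auto simp: has_bochner_integral_iff)
  show "AE \<tau> in lborel. norm (indicator {0..t - norm (y - z) / a} \<tau> *\<^sub>R G_kernel \<sigma> a y z t \<tau>) \<le> norm (?f \<tau>)"
    unfolding real_norm_def by (intro AE_I2 order_trans[OF kernel_bound[OF assms(1)] abs_ge_self])
  show "(\<lambda>\<tau>. indicator {0..t - norm (y - z) / a} \<tau> *\<^sub>R G_kernel \<sigma> a y z t \<tau>) \<in> borel_measurable lborel"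
    unfolding kernel_restrict by measurable
qed

lemma G_finite: "z \<noteq> y \<Longrightarrow> G_finite \<sigma> a y z t"
  using kernel_integrable by (auto simp: G_finite_def)

text \<open>Integrating \<open>kernel_bound\<close> over time gives
  \<open>L / sqrt (norm (y - z))\<close> as a bound for the kernel, and squaring turns this into a
  multiple of \<open>1 / norm (y - z)\<close>, which is locally integrable in the plane.\<close>

lemma G_fun_square_bound:
  "\<exists>K\<ge>0. \<forall>y z. z \<noteq> y \<longrightarrow> (G_fun \<sigma> a y z t)\<^sup>2 \<le> K * (1 / norm (y - z)) * indicator (ball y (a * t)) z"
proof -
  define L where "L = 1 / (2 * pi * a) * (B * (2 / a * sqrt (a * t)))"
  have L: "0 \<le> L" using a_pos t_pos B_nonneg by (simp add: L_def)
  have "(G_fun \<sigma> a y z t)\<^sup>2 \<le> L\<^sup>2 * (1 / norm (y - z)) * indicator (ball y (a * t)) z" if z: "z \<noteq> y" for y z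
  proof (cases "norm (y - z) < a * t")
    case True
    let ?r = "norm (y - z)"
    let ?g = "\<lambda>\<tau>. indicator {0..t - ?r / a} \<tau> *\<^sub>R G_kernel \<sigma> a y z t \<tau>"
    let ?f = "\<lambda>\<tau>. B / sqrt ?r * (indicator {0..t - ?r / a} \<tau> * (1 / sqrt (a * (t - \<tau>) - ?r)))"
    note hb = has_bochner_integral_mult_right[OF has_bochner_integral_inverse_sqrt[OF a_pos True], of "B / sqrt ?r"]
    have "\<bar>integral\<^sup>L lborel ?g\<bar> \<le> integral\<^sup>L lborel ?f"
      using kernel_integrable[OF z True] has_bochner_integral_iff[THEN iffD1, OF hb] kernel_bound[OF z, of _]
      by (intro integral_abs_bound[THEN order_trans] integral_mono) (auto simp: set_integrable_def)
    also have "\<dots> = B / sqrt ?r * (2 / a * sqrt (a * t - ?r))"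
      using has_bochner_integral_iff[THEN iffD1, OF hb] by simp
    also have "\<dots> \<le> B / sqrt ?r * (2 / a * sqrt (a * t))"
      using a_pos B_nonneg by (intro mult_left_mono) auto
    finally have "\<bar>integral\<^sup>L lborel ?g\<bar> \<le> B / sqrt ?r * (2 / a * sqrt (a * t))" .
    then have "1 / (2 * pi * a) * \<bar>integral\<^sup>L lborel ?g\<bar> \<le> 1 / (2 * pi * a) * (B / sqrt ?r * (2 / a * sqrt (a * t)))"
      using a_pos by (intro mult_left_mono) auto
    then have "\<bar>G_fun \<sigma> a y z t\<bar> \<le> L / sqrt ?r"
      using True a_pos by (simp add: G_fun_def set_lebesgue_integral_def abs_mult L_def mult_ac)
    then have "\<bar>G_fun \<sigma> a y z t\<bar>\<^sup>2 \<le> (L / sqrt ?r)\<^sup>2"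
      by (intro power_mono) auto
    also have "\<dots> = L\<^sup>2 * (1 / ?r)" by (simp add: power_divide)
    finally show ?thesis using True by (simp add: dist_norm)
  qed (auto simp: G_fun_def)
  then show ?thesis by (intro exI[of _ "L\<^sup>2"]) simp
qed

lemma G_fun_square_integral: "(\<integral>\<^sup>+ z. ennreal ((G_fun \<sigma> a y z t)\<^sup>2) \<partial>lborel) < \<infinity>"
proof -
  obtain K where K: "0 \<le> K"
    "\<And>y z. z \<noteq> y \<Longrightarrow> (G_fun \<sigma> a y z t)\<^sup>2 \<le> K * (1 / norm (y - z)) * indicator (ball y (a * t)) z"
    using G_fun_square_bound by blast
  have "AE z in lborel. z \<noteq> y"
    by (rule AE_lborel_singleton)
  then have "(\<integral>\<^sup>+ z. ennreal ((G_fun \<sigma> a y z t)\<^sup>2) \<partial>lborel) \<le>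
      (\<integral>\<^sup>+ z. ennreal K * (ennreal (1 / norm (y - z)) * indicator (ball y (a * t)) z) \<partial>lborel)"
    by (intro nn_integral_mono_AE, eventually_elim)
      (use K(1) K(2)[of _ y] in \<open>fastforce simp: ennreal_mult[symmetric] indicator_def intro!: ennreal_leI split: if_splits\<close>)
  also have "\<dots> = ennreal K * (\<integral>\<^sup>+ z. ennreal (1 / norm (y - z)) * indicator (ball y (a * t)) z \<partial>lborel)"
    by (rule nn_integral_cmult) (auto intro!: borel_measurable_times_ennreal borel_measurable_indicator)
  also have "\<dots> < \<infinity>"
    using nn_integral_inverse_norm_ball[of "a * t" y] a_pos t_pos by (simp add: ennreal_mult_less_top)
  finally show ?thesis .
qed

text \<open>Near \<open>(x, t)\<close> the sign of \<sigma> is constant and its size at least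
  \<open>c\<close>. The last \<open>\<eta>\<close> time units then contribute at least a multiple of
  \<open>ln (a * \<eta> / r)\<close>, with \<open>r\<close> the distance from \<open>y\<close> to
  \<open>z\<close>, while earlier times contribute a bounded amount. The radius
  \<open>\<rho>\<close> does not depend on \<open>N\<close>.\<close>

lemma G_fun_blowup:
  assumes "\<sigma> x t \<noteq> 0"
  obtains \<rho> where "0 < \<rho>"
    "\<And>z N. dist z x < \<rho> \<Longrightarrow> \<exists>e>0. \<forall>y. 0 < dist y z \<longrightarrow> dist y z < e \<longrightarrow> N < \<bar>G_fun \<sigma> a y z t\<bar>"
proof -
  define S where "S = sgn (\<sigma> x t)"
  define c where "c = \<bar>\<sigma> x t\<bar> / 2"
  have c: "0 < c" using assms by (simp add: c_def)
  have S: "\<bar>S\<bar> = 1" using assms by (simp add: S_def)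
  have "\<exists>d>0. \<forall>p\<in>UNIV \<times> {0..}. dist p (x, t) < d \<longrightarrow> dist (case p of (z, \<tau>) \<Rightarrow> \<sigma> z \<tau>) (case (x, t) of (z, \<tau>) \<Rightarrow> \<sigma> z \<tau>) < c"
    using cont[unfolded continuous_on_iff, rule_format, of "(x, t)" c] c t_pos by auto
  then obtain d where d: "0 < d"
    and near: "\<And>z \<tau>. 0 \<le> \<tau> \<Longrightarrow> dist (z, \<tau>) (x, t) < d \<Longrightarrow> \<bar>\<sigma> z \<tau> - \<sigma> x t\<bar> < c"
    by (fastforce simp: dist_real_def)
  \<comment> \<open>Half of \<open>d\<close> is left for space and half for time, so that
    \<open>near\<close> applies; \<open>t / 2\<close> keeps the time window inside the positive
    half-line.\<close>
  define \<eta> where "\<eta> = min (d / 2) (t / 2)"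
  have \<eta>: "0 < \<eta>" "\<eta> < t" "\<eta> \<le> d / 2" using d t_pos by (auto simp: \<eta>_def)
  have sgn_ge: "c \<le> S * \<sigma> z \<tau>" if "dist z x < d / 2" "t - \<eta> \<le> \<tau>" "\<tau> \<le> t" for z \<tau>
  proof -
    have "dist (z, \<tau>) (x, t) \<le> dist z x + dist \<tau> t"
      unfolding dist_Pair_Pair by (rule sqrt_sum_squares_le_sum) auto
    also have "\<dots> < d" using that \<eta> by (simp add: dist_real_def)
    finally have "\<bar>\<sigma> z \<tau> - \<sigma> x t\<bar> < c" using near[of \<tau> z] that \<eta> by simp
    then show ?thesis using assms unfolding c_def S_def
      by (cases "\<sigma> x t > 0") (auto simp: sgn_if abs_if split: if_splits)
  qed
  have main: "\<exists>e>0. \<forall>y. 0 < dist y z \<longrightarrow> dist y z < e \<longrightarrow> N < \<bar>G_fun \<sigma> a y z t\<bar>"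
    if z: "dist z x < d / 2" for z N
  proof -
    \<comment> \<open>Chosen so that \<open>c * L / a\<close> equals \<open>2 * pi * a * N\<close>
      plus the bound for the earlier times. Distances below \<open>a * \<eta> * exp (- L)\<close>
      make the logarithm exceed \<open>L\<close>.\<close>
    define L where "L = (2 * pi * a * N + 2 * B / (a * \<eta>) * t) * a / c"
    define e where "e = min (a * \<eta> / 2) (a * \<eta> * exp (- L))"
    have "N < \<bar>G_fun \<sigma> a y z t\<bar>" if y: "0 < dist y z" "dist y z < e" for y
    proof -
      define r where "r = norm (y - z)"
      have r: "0 < r" "r < a * \<eta> / 2" "r < a * \<eta> * exp (- L)"
        using y by (auto simp: r_def e_def dist_norm)
      have yz: "z \<noteq> y" using y by auto
      have \<eta>t: "a * \<eta> < a * t" using \<eta> a_pos by simp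
      have rt: "r < a * t" using r \<eta>t \<eta> a_pos by (smt (verit) field_sum_of_halves mult_pos_pos)
      have ra: "r / a < \<eta>" "0 < r / a" using r a_pos \<eta> by (auto simp: field_simps)
      define s where "s = t - r / a"
      have s: "t - \<eta> < s" "s < t" using ra by (auto simp: s_def)
      let ?k = "\<lambda>\<tau>. sqrt (a\<^sup>2 * (t - \<tau>)\<^sup>2 - r\<^sup>2)"
      let ?g = "\<lambda>\<tau>. indicator {0..s} \<tau> *\<^sub>R G_kernel \<sigma> a y z t \<tau>"
      let ?h1 = "\<lambda>\<tau>. indicator {t - \<eta>..s} \<tau> *\<^sub>R (1 / (a * (t - \<tau>)))"
      let ?h2 = "\<lambda>\<tau>. indicator {0..t - \<eta>} \<tau> *\<^sub>R (2 * B / (a * \<eta>))"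
      \<comment> \<open>An integrable minorant of the signed kernel. It fails at \<open>s\<close>,
        where the kernel is 0 through division by zero, so the two breakpoints, a null set, are left
        out.\<close>
      have ineq: "c * ?h1 \<tau> - ?h2 \<tau> \<le> S * ?g \<tau>" if ts: "\<tau> \<noteq> s" "\<tau> \<noteq> t - \<eta>" for \<tau>
      proof -
        consider "\<tau> < 0 \<or> s < \<tau>" | "0 \<le> \<tau>" "\<tau> < t - \<eta>" | "t - \<eta> < \<tau>" "\<tau> < s"
          using ts by linarith
        then show ?thesis
        proof cases
          case 1
          then show ?thesis using s \<eta> by (auto split: split_indicator)
        next
          \<comment> \<open>At early times the radicand is at least the square of
            \<open>a * \<eta> / 2\<close>, because \<open>a * (t - \<tau>)\<close> exceeds
            \<open>a * \<eta>\<close> and \<open>r\<close> is below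
            \<open>a * \<eta> / 2\<close>.\<close>
          case 2
          have "(a * \<eta> / 2)\<^sup>2 \<le> a\<^sup>2 * (t - \<tau>)\<^sup>2 - r\<^sup>2"
          proof -
            have "a\<^sup>2 * \<eta>\<^sup>2 \<le> a\<^sup>2 * (t - \<tau>)\<^sup>2"
              using 2 \<eta> by (intro mult_left_mono power_mono) auto
            moreover have "r\<^sup>2 \<le> (a * \<eta> / 2)\<^sup>2" using r by (intro power_mono) auto
            moreover have "0 \<le> a\<^sup>2 * \<eta>\<^sup>2" by simp
            moreover have "(a * \<eta> / 2)\<^sup>2 = a\<^sup>2 * \<eta>\<^sup>2 / 4"
              by (simp add: power_mult_distrib power_divide)
            ultimately show ?thesis by linarith
          qed
          then have k: "a * \<eta> / 2 \<le> ?k \<tau>" by (rule real_le_rsqrt)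
          have "0 < a * \<eta> / 2" using a_pos \<eta> by simp
          have "\<bar>?k \<tau>\<bar> = ?k \<tau>" using k \<open>0 < a * \<eta> / 2\<close> by linarith
          then have "\<bar>S * (\<sigma> z \<tau> / ?k \<tau>)\<bar> = \<bar>\<sigma> z \<tau>\<bar> / ?k \<tau>"
            using S by (simp only: abs_mult abs_divide mult_1)
          also have "\<dots> \<le> B / (a * \<eta> / 2)"
            using k \<open>0 < a * \<eta> / 2\<close> bound[of \<tau> z] 2 by (intro frac_le) auto
          also have "\<dots> = 2 * B / (a * \<eta>)" by simp
          finally have "\<bar>S * (\<sigma> z \<tau> / ?k \<tau>)\<bar> \<le> 2 * B / (a * \<eta>)" .
          then have "- (2 * B / (a * \<eta>)) \<le> S * (\<sigma> z \<tau> / ?k \<tau>)"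
            by (subst minus_le_iff) (rule abs_le_D2)
          then show ?thesis using 2 s by (simp add: G_kernel_def r_def norm_minus_commute)
        next
          \<comment> \<open>Dropping \<open>r\<close> from the radicand enlarges the denominator to
            \<open>a * (t - \<tau>)\<close>, and \<open>sgn_ge\<close> bounds the numerator from
            below by \<open>c\<close>.\<close>
          case 3
          have "r < a * (t - \<tau>)" using 3 a_pos by (simp add: s_def field_simps)
          then have "r\<^sup>2 < (a * (t - \<tau>))\<^sup>2" using r by (intro power_strict_mono) auto
          then have k0: "0 < ?k \<tau>" by (simp add: power_mult_distrib)
          have k: "?k \<tau> \<le> a * (t - \<tau>)"
            using 3 s a_pos by (intro real_le_lsqrt) (auto simp: power_mult_distrib)
          have "c * (1 / (a * (t - \<tau>))) \<le> (S * \<sigma> z \<tau>) / ?k \<tau>"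
            using frac_le[OF _ _ k0 k, of "S * \<sigma> z \<tau>" c] sgn_ge[OF z, of \<tau>] 3 s c by simp
          then show ?thesis using 3 s \<eta> by (simp add: G_kernel_def r_def norm_minus_commute)
        qed
      qed
      have i0: "integrable lborel ?g"
        using kernel_integrable[OF yz] rt by (simp add: set_integrable_def r_def s_def)
      have cont1: "continuous_on {t - \<eta>..s} (\<lambda>\<tau>. 1 / (a * (t - \<tau>)))"
        using s a_pos by (intro continuous_intros) auto
      have i1: "integrable lborel ?h1"
        using borel_integrable_atLeastAtMost'[OF cont1] by (simp add: set_integrable_def)
      have i2: "integrable lborel ?h2"
        by (rule borel_integrable_atLeastAtMost'[OF continuous_on_const, unfolded set_integrable_def])
      have "integral\<^sup>L lborel ?h1 = - ln (t - s) / a - - ln (t - (t - \<eta>)) / a"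
      proof (rule integral_FTC_atLeastAtMost)
        fix \<tau> assume "t - \<eta> \<le> \<tau>" "\<tau> \<le> s"
        then have "0 < t - \<tau>" using s by simp
        then have "((\<lambda>\<tau>. - ln (t - \<tau>) / a) has_real_derivative 1 / (a * (t - \<tau>))) (at \<tau> within {t - \<eta>..s})"
          using a_pos by (auto intro!: derivative_eq_intros simp: field_simps)
        then show "((\<lambda>\<tau>. - ln (t - \<tau>) / a) has_vector_derivative 1 / (a * (t - \<tau>))) (at \<tau> within {t - \<eta>..s})"
          by (simp add: has_real_derivative_iff_has_vector_derivative)
      qed (use s cont1 in auto)
      also have "\<dots> = ln (a * \<eta> / r) / a"
        using a_pos r \<eta> by (simp add: s_def ln_div ln_mult field_simps)
      finally have h1: "integral\<^sup>L lborel ?h1 = ln (a * \<eta> / r) / a" .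
      have "integral\<^sup>L lborel ?h2 = (t - \<eta>) * (2 * B / (a * \<eta>))"
        using \<eta> by (simp add: measure_def)
      also have "\<dots> \<le> t * (2 * B / (a * \<eta>))"
        using \<eta> a_pos B_nonneg by (intro mult_right_mono) auto
      finally have h2: "integral\<^sup>L lborel ?h2 \<le> 2 * B / (a * \<eta>) * t" by (simp add: mult.commute)
      have "exp L < a * \<eta> / r" using r by (simp add: exp_minus field_simps)
      then have "L < ln (a * \<eta> / r)" using r a_pos \<eta> by (metis exp_less_cancel_iff exp_ln less_trans exp_gt_zero)
      then have "c * (L / a) < c * (ln (a * \<eta> / r) / a)" using c a_pos by (intro mult_strict_left_mono divide_strict_right_mono)
      moreover have "c * (L / a) = 2 * pi * a * N + 2 * B / (a * \<eta>) * t"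
        using c a_pos by (simp add: L_def)
      moreover have "c * (ln (a * \<eta> / r) / a) - 2 * B / (a * \<eta>) * t \<le> integral\<^sup>L lborel (\<lambda>\<tau>. c * ?h1 \<tau> - ?h2 \<tau>)"
        unfolding Bochner_Integration.integral_diff[OF integrable_mult_right[OF i1] i2] integral_mult_right_zero h1
        by (rule diff_left_mono[OF h2])
      moreover have "integral\<^sup>L lborel (\<lambda>\<tau>. c * ?h1 \<tau> - ?h2 \<tau>) \<le> integral\<^sup>L lborel (\<lambda>\<tau>. S * ?g \<tau>)"
      proof (rule integral_mono_AE)
        have "AE \<tau> in lborel. \<tau> \<noteq> s" "AE \<tau> in lborel. \<tau> \<noteq> t - \<eta>"
          by (rule AE_lborel_singleton)+
        then show "AE \<tau> in lborel. c * ?h1 \<tau> - ?h2 \<tau> \<le> S * ?g \<tau>"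
          by eventually_elim (rule ineq)
      qed (intro Bochner_Integration.integrable_diff integrable_mult_right i0 i1 i2)+
      moreover have "integral\<^sup>L lborel (\<lambda>\<tau>. S * ?g \<tau>) = S * integral\<^sup>L lborel ?g"
        by (rule integral_mult_right_zero)
      ultimately have "2 * pi * a * N < S * integral\<^sup>L lborel ?g" by linarith
      also have "\<dots> \<le> \<bar>integral\<^sup>L lborel ?g\<bar>" using S by (metis abs_ge_self abs_mult mult_1)
      finally have "N < 1 / (2 * pi * a) * \<bar>integral\<^sup>L lborel ?g\<bar>" using a_pos by (simp add: field_simps)
      then show ?thesis using rt a_pos
        by (simp add: G_fun_def set_lebesgue_integral_def abs_mult r_def s_def)
    qed
    moreover have "0 < e" using a_pos \<eta> by (simp add: e_def)
    ultimately show ?thesis by blast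
  qed
  show ?thesis using that[of "d / 2"] main d by auto
qed

end

section \<open>Independence in the LePage construction\<close>

text \<open>Serves to extract one of the three families from the family indexed by the sum type;
  \<open>inv_into\<close> carries the chosen events over to the image indices.\<close>

lemma (in prob_space) indep_sets_reindex:
  assumes "indep_sets F (f ` I)" "inj_on f I"
  shows "indep_sets (\<lambda>i. F (f i)) I"
proof (rule indep_setsI)
  show "F (f i) \<subseteq> events" if "i \<in> I" for i
    using assms(1) that by (auto simp: indep_sets_def)
  fix A J assume J: "J \<noteq> {}" "J \<subseteq> I" "finite J" "\<forall>j\<in>J. A j \<in> F (f j)"
  have inj: "inj_on f J" using assms(2) J(2) by (rule inj_on_subset)
  have inv: "inv_into J f (f j) = j" if "j \<in> J" for j
    using inj that by simp
  have "prob (\<Inter>i\<in>f ` J. A (inv_into J f i)) = (\<Prod>i\<in>f ` J. prob (A (inv_into J f i)))"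
    by (rule indep_setsD[OF assms(1)]) (use J inv in auto)
  then show "prob (\<Inter>j\<in>J. A j) = (\<Prod>j\<in>J. prob (A j))"
    by (simp add: prod.reindex[OF inj] inv)
qed

definition lepage_events where
  "lepage_events M E \<xi> g i = (case i of
        Inl n \<Rightarrow> {E n -` A \<inter> space M | A. A \<in> sets borel}
      | Inr (Inl n) \<Rightarrow> {\<xi> n -` A \<inter> space M | A. A \<in> sets borel}
      | Inr (Inr n) \<Rightarrow> {g n -` A \<inter> space M | A. A \<in> sets borel})"

text \<open>All the randomness except \<open>g j\<close>. It is used twice: for the orthogonality of
  the terms and for the independence behind the final Fubini argument.\<close>

definition others_algebra where
  "others_algebra M E \<xi> g j = sigma (space M) (\<Union>i\<in>-{Inr (Inr j)}. lepage_events M E \<xi> g i)"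

lemma lepage_events_subset: "lepage_events M E \<xi> g i \<subseteq> Pow (space M)"
  by (auto simp: lepage_events_def split: sum.splits)

lemma space_others_algebra [simp]: "space (others_algebra M E \<xi> g j) = space M"
  unfolding others_algebra_def by (rule space_measure_of) (use lepage_events_subset in fastforce)

lemma sets_others_algebra:
  "sets (others_algebra M E \<xi> g j) = sigma_sets (space M) (\<Union>i\<in>-{Inr (Inr j)}. lepage_events M E \<xi> g i)"
  unfolding others_algebra_def by (rule sets_measure_of) (use lepage_events_subset in fastforce)

lemma measurable_othersI:
  fixes X :: "'a \<Rightarrow> 'b :: topological_space"
  assumes "\<And>A. A \<in> sets borel \<Longrightarrow> X -` A \<inter> space M \<in> lepage_events M E \<xi> g i" "i \<noteq> Inr (Inr j)"
  shows "X \<in> borel_measurable (others_algebra M E \<xi> g j)"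
proof (rule measurableI)
  fix A :: "'b set" assume "A \<in> sets borel"
  then show "X -` A \<inter> space (others_algebra M E \<xi> g j) \<in> sets (others_algebra M E \<xi> g j)"
    using assms by (auto simp: sets_others_algebra intro!: sigma_sets.Basic)
qed simp

lemma measurable_others_E: "E n \<in> borel_measurable (others_algebra M E \<xi> g j)"
  by (rule measurable_othersI[where i="Inl n"]) (simp add: lepage_events_def, blast?)+

lemma measurable_others_\<xi>: "\<xi> n \<in> borel_measurable (others_algebra M E \<xi> g j)"
  by (rule measurable_othersI[where i="Inr (Inl n)"]) (simp add: lepage_events_def, blast?)+

lemma measurable_others_g: "n \<noteq> j \<Longrightarrow> g n \<in> borel_measurable (others_algebra M E \<xi> g j)"
  by (rule measurable_othersI[where i="Inr (Inr n)"]) (simp add: lepage_events_def, blast?)+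

lemma Int_stable_vimage_sets: "Int_stable {X -` A \<inter> S | A. A \<in> sets N}"
proof (rule Int_stableI)
  fix a b assume "a \<in> {X -` A \<inter> S | A. A \<in> sets N}" "b \<in> {X -` A \<inter> S | A. A \<in> sets N}"
  then obtain A B where "a = X -` A \<inter> S" "b = X -` B \<inter> S" "A \<in> sets N" "B \<in> sets N"
    by blast
  then show "a \<inter> b \<in> {X -` A \<inter> S | A. A \<in> sets N}"
    by (intro CollectI exI[of _ "A \<inter> B"]) auto
qed

locale lepage_sequences = prob_space M for M :: "'a measure" +
  fixes E g :: "nat \<Rightarrow> 'a \<Rightarrow> real" and \<xi> :: "nat \<Rightarrow> 'a \<Rightarrow> real^2"
  assumes E_rv [measurable]: "\<And>n. E n \<in> borel_measurable M"
    and g_rv [measurable]: "\<And>n. g n \<in> borel_measurable M"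
    and \<xi>_rv [measurable]: "\<And>n. \<xi> n \<in> borel_measurable M"
    and indep: "lepage_indep M E \<xi> g"
begin

lemma indep_lepage_events: "indep_sets (lepage_events M E \<xi> g) UNIV"
  using indep unfolding lepage_indep_def lepage_events_def .

lemma indep_E: "indep_vars (\<lambda>_. borel) E UNIV"
proof -
  have "indep_sets (\<lambda>n. lepage_events M E \<xi> g (Inl n)) UNIV"
    by (rule indep_sets_reindex) (auto intro: indep_sets_mono_index[OF _ indep_lepage_events])
  then show ?thesis by (auto simp: indep_vars_def2 lepage_events_def)
qed

lemma indep_\<xi>: "indep_vars (\<lambda>_. borel) \<xi> UNIV"
proof -
  have "indep_sets (\<lambda>n. lepage_events M E \<xi> g (Inr (Inl n))) UNIV"
    by (rule indep_sets_reindex[where f="\<lambda>n. Inr (Inl n)"])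
      (auto intro: indep_sets_mono_index[OF _ indep_lepage_events] simp: inj_on_def)
  then show ?thesis by (auto simp: indep_vars_def2 lepage_events_def)
qed

abbreviation "oth \<equiv> others_algebra M E \<xi> g"

lemma lepage_events_sub_events: "lepage_events M E \<xi> g i \<subseteq> events"
  using indep_lepage_events by (auto simp: indep_sets_def)

lemma subalgebra_others_algebra: "subalgebra M (oth j)"
  unfolding subalgebra_def sets_others_algebra
  using lepage_events_sub_events by (auto intro!: sets.sigma_sets_subset)

text \<open>The indices split into that of \<open>g j\<close> and all others, and disjoint groups of
  independent intersection-stable families generate independent sigma-algebras. The map
  \<open>h\<close> lets \<open>g j\<close> be repackaged later as a sequence of pairs.\<close>

lemma indep_var_others:
  assumes Y: "Y \<in> measurable (oth j) N" and h: "h \<in> measurable borel L"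
  shows "indep_var N Y L (\<lambda>\<omega>. h (g j \<omega>))"
proof -
  let ?G = "\<lambda>\<omega>. h (g j \<omega>)"
  define I where "I = (\<lambda>b. if b then - {Inr (Inr j)} else {Inr (Inr j)} :: (nat + nat + nat) set)"
  have "indep_sets (\<lambda>b. sigma_sets (space M) (\<Union>i\<in>I b. lepage_events M E \<xi> g i)) UNIV"
  proof (rule indep_sets_collect_sigma)
    show "indep_sets (lepage_events M E \<xi> g) (\<Union>b\<in>UNIV. I b)"
      by (rule indep_sets_mono_index[OF _ indep_lepage_events]) simp
    show "disjoint_family_on I UNIV"
      by (auto simp: disjoint_family_on_def I_def)
    show "Int_stable (lepage_events M E \<xi> g i)" for i
      unfolding lepage_events_def by (auto split: sum.split intro: Int_stable_vimage_sets)
  qed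
  then have "indep_sets (case_bool {Y -` A \<inter> space M | A. A \<in> sets N} {?G -` A \<inter> space M | A. A \<in> sets L}) UNIV"
  proof (rule indep_sets_mono_sets)
    fix b :: bool
    show "(case b of True \<Rightarrow> {Y -` A \<inter> space M | A. A \<in> sets N} | False \<Rightarrow> {?G -` A \<inter> space M | A. A \<in> sets L})
      \<subseteq> sigma_sets (space M) (\<Union>i\<in>I b. lepage_events M E \<xi> g i)"
    proof (cases b)
      case False
      have "?G -` A \<inter> space M \<in> lepage_events M E \<xi> g (Inr (Inr j))" if "A \<in> sets L" for A
        using measurable_sets[OF h that] by (auto simp: lepage_events_def intro!: exI[of _ "h -` A"])
      then show ?thesis using False by (auto simp: I_def)
    next
      case True
      have "Y -` A \<inter> space M \<in> sets (oth j)" if "A \<in> sets N" for A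
        using measurable_sets[OF Y that] by simp
      then show ?thesis using True by (auto simp: I_def sets_others_algebra)
    qed
  qed
  moreover have "Y \<in> measurable M N"
    by (rule measurable_from_subalg[OF subalgebra_others_algebra Y])
  moreover have "?G \<in> measurable M L"
    by (rule measurable_compose[OF g_rv h])
  moreover have "(\<lambda>b. {case_bool Y ?G b -` A \<inter> space M | A. A \<in> sets (case_bool N L b)}) =
      case_bool {Y -` A \<inter> space M | A. A \<in> sets N} {?G -` A \<inter> space M | A. A \<in> sets L}"
    by (rule ext) (simp split: bool.split)
  ultimately show ?thesis
    unfolding indep_var_def indep_vars_def2 by (simp split: bool.split)
qed

end

section \<open>Convergence and unboundedness of the LePage series\<close>

text \<open>A \<open>powr\<close> vanishes only at base 0, and for \<alpha> in (0, 2) the cosine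
  vanishes only at 1, where the value is \<open>pi / 2\<close> by definition.\<close>

lemma C_alpha_nonzero:
  assumes "0 < \<alpha>" "\<alpha> < 2"
  shows "C_alpha \<alpha> \<noteq> 0"
proof (cases "\<alpha> = 1")
  case False
  have "cos (pi * \<alpha> / 2) \<noteq> 0"
  proof (cases "\<alpha> < 1")
    case True
    then have "0 < cos (pi * \<alpha> / 2)" using assms by (intro cos_gt_zero) auto
    then show ?thesis by simp
  next
    case False
    then have "cos (pi * \<alpha> / 2) < cos (pi / 2)"
      using assms \<open>\<alpha> \<noteq> 1\<close> by (intro cos_monotone_0_pi) auto
    then show ?thesis by simp
  qed
  moreover have "0 < Gamma (2 - \<alpha>)" using assms by (intro Gamma_real_pos) simp
  ultimately show ?thesis using False by (simp add: C_alpha_def)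
qed (simp add: C_alpha_def)

text \<open>The second variable is padded to a sequence of pairs because \<open>indep_var\<close> requires both variables
  to have the same value type.\<close>
lemma (in prob_space) AE_unbounded_perturbation:
  fixes T R :: "nat \<Rightarrow> 'a \<Rightarrow> real" and g :: "'a \<Rightarrow> real"
  assumes indep: "indep_var (PiM UNIV (\<lambda>_::nat. borel)) (\<lambda>\<omega> n. (T n \<omega>, R n \<omega>))
      (PiM UNIV (\<lambda>_::nat. borel)) (\<lambda>\<omega> n. (g \<omega>, 0))"
    and nonatomic: "\<And>c. AE \<omega> in M. g \<omega> \<noteq> c"
  shows "AE \<omega> in M. (\<forall>N::nat. \<exists>n. real N < \<bar>T n \<omega>\<bar>) \<longrightarrow> (\<forall>N::nat. \<exists>n. real N < \<bar>T n \<omega> * g \<omega> + R n \<omega>\<bar>)"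
proof -
  let ?V = "\<lambda>\<omega> n. (T n \<omega>, R n \<omega>)"
  let ?W = "\<lambda>\<omega> (n::nat). (g \<omega>, 0::real)"
  let ?P = "PiM UNIV (\<lambda>_::nat. borel :: (real \<times> real) measure)"
  define Q where "Q = (\<lambda>(v :: nat \<Rightarrow> real \<times> real, u :: real). (\<forall>N::nat. \<exists>n. real N < \<bar>fst (v n)\<bar>) \<longrightarrow>
      (\<forall>N::nat. \<exists>n. real N < \<bar>fst (v n) * u + snd (v n)\<bar>))"
  \<comment> \<open>\<open>Q'\<close> reads \<open>u\<close> off coordinate 0 of the padded second
    variable.\<close>
  define Q' where "Q' = (\<lambda>p :: (nat \<Rightarrow> real \<times> real) \<times> (nat \<Rightarrow> real \<times> real). Q (fst p, fst (snd p 0)))"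
  have V [measurable]: "?V \<in> measurable M ?P" and W [measurable]: "?W \<in> measurable M ?P"
    using indep by (auto dest: indep_var_rv1 indep_var_rv2)
  have fst_snd: "fst \<in> borel_measurable (borel :: (real \<times> real) measure)"
    "snd \<in> borel_measurable (borel :: (real \<times> real) measure)"
    by (simp_all add: borel_prod[symmetric])
  have c1: "(\<lambda>p. fst p n) \<in> measurable (?P \<Otimes>\<^sub>M ?P) borel" for n
    by (rule measurable_compose[OF measurable_fst measurable_component_singleton]) simp
  have c2: "(\<lambda>p. snd p n) \<in> measurable (?P \<Otimes>\<^sub>M ?P) borel" for n
    by (rule measurable_compose[OF measurable_snd measurable_component_singleton]) simp
  note [measurable] = measurable_compose[OF c1 fst_snd(1)] measurable_compose[OF c1 fst_snd(2)]
    measurable_compose[OF c2 fst_snd(1)]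
  have Qm: "Measurable.pred (?P \<Otimes>\<^sub>M ?P) Q'"
    unfolding Q'_def Q_def split_beta fst_conv snd_conv by measurable
  \<comment> \<open>Two values \<open>u\<close>, \<open>u'\<close> with bounded sequences would bound \<open>(u - u') * fst (v n)\<close>.\<close>
  have uniq: "u = u'" if unb: "\<forall>N::nat. \<exists>n. real N < \<bar>fst (v n)\<bar>" and nQ: "\<not> Q (v, u)" "\<not> Q (v, u')" for v u u'
  proof (rule ccontr)
    assume ne: "u \<noteq> u'"
    obtain N1 :: nat where N1: "\<And>n. \<bar>fst (v n) * u + snd (v n)\<bar> \<le> real N1"
      using nQ(1) by (auto simp: Q_def not_less)
    obtain N2 :: nat where N2: "\<And>n. \<bar>fst (v n) * u' + snd (v n)\<bar> \<le> real N2"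
      using nQ(2) by (auto simp: Q_def not_less)
    have *: "\<bar>fst (v n)\<bar> \<le> (real N1 + real N2) / \<bar>u - u'\<bar>" for n
    proof -
      have "\<bar>fst (v n)\<bar> * \<bar>u - u'\<bar> = \<bar>(fst (v n) * u + snd (v n)) - (fst (v n) * u' + snd (v n))\<bar>"
        by (simp add: abs_mult[symmetric] algebra_simps)
      also have "\<dots> \<le> real N1 + real N2" using N1[of n] N2[of n] by linarith
      finally show ?thesis using ne by (simp add: field_simps)
    qed
    obtain N :: nat where "(real N1 + real N2) / \<bar>u - u'\<bar> < real N"
      using reals_Archimedean2 by blast
    moreover obtain n where "real N < \<bar>fst (v n)\<bar>" using unb by blast
    ultimately show False using *[of n] by linarith
  qed
  interpret G: prob_space "distr M ?P ?W" by (rule prob_space_distr) (rule W)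
  interpret V: prob_space "distr M ?P ?V" by (rule prob_space_distr) (rule V)
  interpret VG: pair_sigma_finite "distr M ?P ?V" "distr M ?P ?W" ..
  \<comment> \<open>For a frozen sequence \<open>v\<close> there is at most one bad value of
    \<open>u\<close> by \<open>uniq\<close>, and \<open>nonatomic\<close> excludes it almost
    surely.\<close>
  have sec: "AE w in distr M ?P ?W. Q' (v, w)" for v
  proof (cases "\<exists>c. \<not> Q (v, c)")
    case True
    then obtain c where c: "\<not> Q (v, c)" by blast
    then have "\<forall>N::nat. \<exists>n. real N < \<bar>fst (v n)\<bar>" by (auto simp: Q_def)
    then have "Q (v, u)" if "u \<noteq> c" for u using uniq c that by blast
    then have "AE \<omega> in M. Q' (v, ?W \<omega>)"
      using nonatomic[of c] by (auto simp: Q'_def)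
    moreover have "{w \<in> space ?P. Q' (v, w)} \<in> sets ?P"
      using measurable_compose[OF measurable_Pair1' Qm, of v] by (simp add: pred_def space_PiM)
    ultimately show ?thesis by (subst AE_distr_iff) auto
  qed (auto simp: Q'_def)
  \<comment> \<open>The statement on sections gives one for the product of the marginal laws, which
    by independence is the joint law.\<close>
  have "AE p in distr M ?P ?V \<Otimes>\<^sub>M distr M ?P ?W. Q' p"
  proof (rule VG.AE_pair_measure)
    have "sets (distr M ?P ?V \<Otimes>\<^sub>M distr M ?P ?W) = sets (?P \<Otimes>\<^sub>M ?P)"
      by (intro sets_pair_measure_cong) auto
    then show "{p \<in> space (distr M ?P ?V \<Otimes>\<^sub>M distr M ?P ?W). Q' p} \<in> sets (distr M ?P ?V \<Otimes>\<^sub>M distr M ?P ?W)"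
      using Qm by (simp add: pred_def space_pair_measure)
  qed (use sec in auto)
  also have "distr M ?P ?V \<Otimes>\<^sub>M distr M ?P ?W = distr M (?P \<Otimes>\<^sub>M ?P) (\<lambda>\<omega>. (?V \<omega>, ?W \<omega>))"
    using indep by (simp add: indep_var_distribution_eq)
  finally have "AE \<omega> in M. Q' (?V \<omega>, ?W \<omega>)"
    by (subst (asm) AE_distr_iff) (use Qm in \<open>auto simp: pred_def\<close>)
  then show ?thesis by (simp add: Q_def Q'_def)
qed

locale lepage = lepage_sequences M E g \<xi> + wave_kernel a t B \<sigma>
  for M :: "'a measure" and E g \<xi> a t B \<sigma> +
  fixes \<alpha> s :: real and \<phi> :: "real^2 \<Rightarrow> real"
  assumes \<alpha>: "0 < \<alpha>" "\<alpha> < 2" and s: "0 < s"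
    and \<phi>_cont: "continuous_on UNIV \<phi>" and \<phi>_pos: "\<And>z. 0 < \<phi> z"
    and E_dist: "\<And>i. distributed M lborel (E i) (\<lambda>s. ennreal (exponential_density 1 s))"
    and \<xi>_dist: "\<And>k. distributed M lborel (\<xi> k) (\<lambda>z. ennreal (\<phi> z))"
    and g_dist: "\<And>k. distributed M lborel (g k) (\<lambda>r. ennreal (normal_density 0 s r))"
begin

lemma \<phi>_measurable [measurable]: "\<phi> \<in> borel_measurable borel"
  using \<phi>_cont by (rule borel_measurable_continuous_onI)

section \<open>Positivity and linear growth of the arrival times\<close>

lemma AE_E_pos: "AE \<omega> in M. 0 < E i \<omega>"
proof -
  have "AE x in lborel. x \<noteq> (0::real)" by (rule AE_lborel_singleton)
  then have "AE x in lborel. 0 < ennreal (exponential_density 1 x) \<longrightarrow> 0 < x"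
    by eventually_elim (auto simp: exponential_density_def)
  then show ?thesis by (subst distributed_AE2[OF E_dist]) auto
qed

lemma AE_arrival_pos: "AE \<omega> in M. \<forall>k. 0 < arrival E k \<omega>"
proof -
  have "AE \<omega> in M. \<forall>i. 0 < E i \<omega>" using AE_E_pos by (simp add: AE_all_countable)
  then show ?thesis by eventually_elim (auto simp: arrival_def intro!: sum_pos)
qed

text \<open>The Laplace transform at 1: the integrand against Lebesgue measure is half the
  exponential density of rate 2.\<close>

lemma nn_integral_exp_E: "(\<integral>\<^sup>+ \<omega>. ennreal (exp (- E i \<omega>)) \<partial>M) = ennreal (1 / 2)"
proof -
  interpret X: prob_space "density lborel (exponential_density 2)"
    by (rule prob_space_exponential_density) simp
  have "(\<integral>\<^sup>+ \<omega>. ennreal (exp (- E i \<omega>)) \<partial>M) =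
      (\<integral>\<^sup>+ x. ennreal (exponential_density 1 x) * ennreal (exp (- x)) \<partial>lborel)"
    by (rule distributed_nn_integral[OF E_dist, symmetric]) measurable
  also have "\<dots> = (\<integral>\<^sup>+ x. ennreal (1 / 2) * ennreal (exponential_density 2 x) \<partial>lborel)"
  proof (intro nn_integral_cong)
    fix x :: real
    have "exponential_density 1 x * exp (- x) = 1 / 2 * exponential_density 2 x"
      by (simp add: exponential_density_def exp_add[symmetric])
    then show "ennreal (exponential_density 1 x) * ennreal (exp (- x)) = ennreal (1 / 2) * ennreal (exponential_density 2 x)"
      by (subst (1 2) ennreal_mult[symmetric]) (simp_all only: erlang_density_nonneg exp_ge_zero zero_le_one zero_le_numeral zero_le_divide_1_iff)
  qed
  also have "\<dots> = ennreal (1 / 2) * (\<integral>\<^sup>+ x. ennreal (exponential_density 2 x) \<partial>lborel)"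
    by (rule nn_integral_cmult) measurable
  also have "(\<integral>\<^sup>+ x. ennreal (exponential_density 2 x) \<partial>lborel) = 1"
    using X.emeasure_space_1 by (simp add: emeasure_density)
  finally show ?thesis by simp
qed

lemma nn_integral_exp_arrival: "(\<integral>\<^sup>+ \<omega>. ennreal (exp (- arrival E k \<omega>)) \<partial>M) = ennreal ((1 / 2) ^ Suc k)"
proof -
  have "indep_vars (\<lambda>_. borel) (\<lambda>i \<omega>. ennreal (exp (- E i \<omega>))) {..k}"
    by (rule indep_vars_compose2[OF indep_vars_subset[OF indep_E]]) auto
  then have "(\<integral>\<^sup>+ \<omega>. (\<Prod>i\<le>k. ennreal (exp (- E i \<omega>))) \<partial>M) = (\<Prod>i\<le>k. \<integral>\<^sup>+ \<omega>. ennreal (exp (- E i \<omega>)) \<partial>M)"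
    by (intro indep_vars_nn_integral) auto
  moreover have "(\<Prod>i\<le>k. ennreal (exp (- E i \<omega>))) = ennreal (exp (- arrival E k \<omega>))" for \<omega>
    by (simp add: prod_ennreal arrival_def exp_sum sum_negf[symmetric])
  moreover have "(\<Prod>i\<le>k. ennreal (1 / 2)) = ennreal ((1 / 2) ^ Suc k)"
    by (simp only: prod_constant card_atMost) (rule ennreal_power, simp)
  ultimately show ?thesis
    by (simp only: nn_integral_exp_E)
qed

lemma arrival_measurable [measurable (raw)]:
  assumes "\<And>i. E i \<in> borel_measurable N"
  shows "arrival E k \<in> borel_measurable N"
  unfolding arrival_def[abs_def] using assms by measurable

text \<open>A Chernoff bound: \<open>arrival E k\<close> sums \<open>k + 1\<close> interarrival
  times, so the bound at index \<open>k\<close> fails with probability at most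
  \<open>(exp (1 / 2) / 2) ^ Suc k\<close>. This is summable because \<open>exp 1 < 4\<close>, and
  Borel-Cantelli applies.\<close>

lemma AE_arrival_linear: "AE \<omega> in M. eventually (\<lambda>k. real (Suc k) / 2 \<le> arrival E k \<omega>) sequentially"
proof -
  let ?A = "\<lambda>k. {\<omega> \<in> space M. arrival E k \<omega> < real (Suc k) / 2}"
  let ?q = "exp (1 / 2) / 2 :: real"
  have [measurable]: "arrival E k \<in> borel_measurable M" for k by measurable
  have q: "?q < 1"
  proof -
    have "(exp (1 / 2) :: real)\<^sup>2 = exp 1" by (simp add: power2_eq_square exp_add[symmetric])
    also have "\<dots> < 2\<^sup>2" using exp_le by simp
    finally have "exp (1 / 2) < (2 :: real)" by (rule power2_less_imp_less) simp
    then show ?thesis by simp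
  qed
  have "prob (?A k) \<le> ?q ^ Suc k" for k
  proof -
    have "emeasure M (?A k) \<le> emeasure M {\<omega> \<in> space M. 1 \<le> ennreal (exp (real (Suc k) / 2)) * ennreal (exp (- arrival E k \<omega>))}"
      by (rule emeasure_mono) (auto simp: ennreal_mult[symmetric] exp_add[symmetric])
    also have "\<dots> \<le> ennreal (exp (real (Suc k) / 2)) * (\<integral>\<^sup>+ \<omega>. ennreal (exp (- arrival E k \<omega>)) * indicator (space M) \<omega> \<partial>M)"
      by (rule nn_integral_Markov_inequality) measurable
    also have "(\<integral>\<^sup>+ \<omega>. ennreal (exp (- arrival E k \<omega>)) * indicator (space M) \<omega> \<partial>M) = ennreal ((1 / 2) ^ Suc k)"
      unfolding nn_integral_exp_arrival[symmetric] by (intro nn_integral_cong) simp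
    also have "ennreal (exp (real (Suc k) / 2)) * ennreal ((1 / 2) ^ Suc k) = ennreal (?q ^ Suc k)"
    proof -
      have "exp (real (Suc k) / 2) = exp (1 / 2 :: real) ^ Suc k"
        by (simp only: exp_of_nat_mult[symmetric] times_divide_eq_right mult_1_right)
      then show ?thesis
        by (simp only: ennreal_mult[symmetric] power_mult_distrib[symmetric] zero_le_power exp_ge_zero) simp
    qed
    finally show ?thesis by (simp add: emeasure_eq_measure)
  qed
  then have "summable (\<lambda>k. prob (?A k))"
    by (intro summable_comparison_test'[OF summable_mult[OF summable_geometric, of ?q ?q], of 0]) (use q in auto)
  then have "AE \<omega> in M. eventually (\<lambda>k. \<omega> \<in> space M - ?A k) sequentially"
    by (intro borel_cantelli_AE1) (auto simp: emeasure_eq_measure)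
  then show ?thesis
    by eventually_elim (auto elim!: eventually_mono)
qed

section \<open>Almost sure convergence at a fixed point\<close>

definition coef where
  "coef k y \<omega> = C_alpha \<alpha> * arrival E k \<omega> powr (-1 / \<alpha>) * \<phi> (\<xi> k \<omega>) powr (-1 / \<alpha>) * G_fun \<sigma> a y (\<xi> k \<omega>) t"

lemma lepage_term_eq: "lepage_term \<alpha> a \<sigma> \<phi> E \<xi> g y t \<omega> k = coef k y \<omega> * g k \<omega>"
  by (simp add: lepage_term_def coef_def)

lemma coef_measurable [measurable (raw)]:
  assumes [measurable]: "\<And>i. E i \<in> borel_measurable N" "\<And>i. \<xi> i \<in> borel_measurable N"
  shows "coef k y \<in> borel_measurable N"
proof -
  have [measurable]: "(\<lambda>\<omega>. G_fun \<sigma> a y (\<xi> k \<omega>) t) \<in> borel_measurable N"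
    by (rule measurable_compose[OF _ G_fun_measurable]) measurable
  show ?thesis unfolding coef_def[abs_def] by measurable
qed

definition weight where "weight y z = (\<phi> z powr (-1 / \<alpha>) * G_fun \<sigma> a y z t)\<^sup>2"

lemma weight_measurable [measurable]: "weight y \<in> borel_measurable borel"
  unfolding weight_def[abs_def] using G_fun_measurable[of y] by measurable

text \<open>The kernel vanishes outside a ball, and on its closure
  \<open>\<phi> z * \<phi> z powr (-2 / \<alpha>)\<close> is bounded, since \<phi> is continuous and
  positive on a compact set. Square integrability of the kernel does the rest.\<close>

lemma weight_integral:
  "integrable M (\<lambda>\<omega>. weight y (\<xi> k \<omega>))"
  "expectation (\<lambda>\<omega>. weight y (\<xi> k \<omega>)) = (\<integral>z. \<phi> z * weight y z \<partial>lborel)"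
proof -
  show "expectation (\<lambda>\<omega>. weight y (\<xi> k \<omega>)) = (\<integral>z. \<phi> z * weight y z \<partial>lborel)"
    by (rule distributed_integral[OF \<xi>_dist, symmetric]) (use \<phi>_pos in \<open>auto intro: less_imp_le\<close>)
  have "continuous_on (cball y (a * t)) (\<lambda>z. \<phi> z * (\<phi> z powr (-1 / \<alpha>))\<^sup>2)"
    using \<phi>_pos by (intro continuous_intros continuous_on_subset[OF \<phi>_cont]) (auto simp: less_imp_neq[symmetric])
  then have "bounded ((\<lambda>z. \<phi> z * (\<phi> z powr (-1 / \<alpha>))\<^sup>2) ` cball y (a * t))"
    by (intro compact_imp_bounded compact_continuous_image) auto
  then obtain K where "\<forall>v\<in>(\<lambda>z. \<phi> z * (\<phi> z powr (-1 / \<alpha>))\<^sup>2) ` cball y (a * t). norm v \<le> K"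
    unfolding bounded_iff by blast
  then have K: "\<bar>\<phi> z * (\<phi> z powr (-1 / \<alpha>))\<^sup>2\<bar> \<le> K" if "z \<in> cball y (a * t)" for z
    using that by (metis (no_types, lifting) imageI real_norm_def)
  have K0: "0 \<le> K" using K[of y] a_pos t_pos by (auto intro: order_trans[OF abs_ge_zero])
  have weight_nonneg: "0 \<le> weight y z" for z by (simp add: weight_def)
  have le: "\<phi> z * weight y z \<le> K * (G_fun \<sigma> a y z t)\<^sup>2" for z
  proof (cases "norm (y - z) < a * t")
    case True
    then have "\<phi> z * (\<phi> z powr (-1 / \<alpha>))\<^sup>2 \<le> K" using K[of z] by (auto simp: dist_norm)
    then show ?thesis unfolding weight_def power_mult_distrib mult.assoc[symmetric]
      by (intro mult_right_mono) auto
  qed (simp add: weight_def G_fun_def)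
  have "(\<integral>\<^sup>+ \<omega>. ennreal (weight y (\<xi> k \<omega>)) \<partial>M) = (\<integral>\<^sup>+ z. ennreal (\<phi> z) * ennreal (weight y z) \<partial>lborel)"
    by (rule distributed_nn_integral[OF \<xi>_dist, symmetric]) measurable
  also have "\<dots> \<le> (\<integral>\<^sup>+ z. ennreal K * ennreal ((G_fun \<sigma> a y z t)\<^sup>2) \<partial>lborel)"
    using le K0 \<phi>_pos by (intro nn_integral_mono)
      (auto simp: ennreal_mult[symmetric] weight_def less_imp_le intro!: ennreal_leI)
  also have "\<dots> = ennreal K * (\<integral>\<^sup>+ z. ennreal ((G_fun \<sigma> a y z t)\<^sup>2) \<partial>lborel)"
    by (rule nn_integral_cmult) (use G_fun_measurable[of y] in measurable)
  also have "\<dots> < \<infinity>"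
    using G_fun_square_integral[of y] by (simp add: ennreal_mult_less_top)
  finally show "integrable M (\<lambda>\<omega>. weight y (\<xi> k \<omega>))"
    by (intro integrableI_nonneg AE_I2) (measurable, simp_all add: weight_nonneg)
qed

lemma g_moments:
  "integrable M (g k)" "expectation (g k) = 0"
  "integrable M (\<lambda>\<omega>. (g k \<omega>)\<^sup>2)" "expectation (\<lambda>\<omega>. (g k \<omega>)\<^sup>2) = s\<^sup>2"
proof -
  show e: "expectation (g k) = 0"
    by (rule normal_distributed_expectation[OF s g_dist])
  show "expectation (\<lambda>\<omega>. (g k \<omega>)\<^sup>2) = s\<^sup>2"
    using normal_distributed_variance[OF s g_dist, of k] by (simp add: e)
  show sq: "integrable M (\<lambda>\<omega>. (g k \<omega>)\<^sup>2)"
    using integrable_normal_moment[OF s, of 0 2]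
    by (subst distributed_integrable[OF g_dist, symmetric, where g="\<lambda>x. x\<^sup>2"]) auto
  show "integrable M (g k)" by (rule integrable_of_square_integrable[OF _ sq]) measurable
qed

text \<open>\<open>A\<close> sets the coefficient to 0 when the arrival time is below its linear
  bound, as the power \<open>-2 / \<alpha>\<close> of a small arrival time need not have finite
  mean. The truncated series \<open>X\<close> has summable second moments because
  \<open>2 / \<alpha> > 1\<close>, and almost surely it differs from the original in finitely many
  terms.\<close>

lemma AE_summable_lepage_term: "AE \<omega> in M. summable (lepage_term \<alpha> a \<sigma> \<phi> E \<xi> g y t \<omega>)"
proof -
  define A where "A = (\<lambda>k \<omega>. coef k y \<omega> * (if real (Suc k) / 2 \<le> arrival E k \<omega> then 1 else 0))"
  define X where "X = (\<lambda>k \<omega>. A k \<omega> * g k \<omega>)"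
  define b where "b = (\<lambda>k::nat. (C_alpha \<alpha>)\<^sup>2 * (real (Suc k) / 2) powr (-2 / \<alpha>))"
  have A_meas: "A k \<in> borel_measurable N"
    if [measurable]: "\<And>i. E i \<in> borel_measurable N" "\<And>i. \<xi> i \<in> borel_measurable N" for k N
    unfolding A_def by measurable
  have A_oth: "A k \<in> borel_measurable (oth j)" for k j
    by (rule A_meas) (rule measurable_others_E measurable_others_\<xi>)+
  have [measurable]: "A k \<in> borel_measurable M" for k
    by (rule A_meas) measurable
  have A_le: "(A k \<omega>)\<^sup>2 \<le> b k * weight y (\<xi> k \<omega>)" for k \<omega>
  proof (cases "real (Suc k) / 2 \<le> arrival E k \<omega>")
    case True
    have sq: "(u powr (-1 / \<alpha>))\<^sup>2 = u powr (-2 / \<alpha>)" for u :: real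
      by (simp add: power2_eq_square powr_add[symmetric])
    have "arrival E k \<omega> powr (-2 / \<alpha>) \<le> (real (Suc k) / 2) powr (-2 / \<alpha>)"
      using True \<alpha> by (intro powr_mono2') auto
    then have "(C_alpha \<alpha>)\<^sup>2 * arrival E k \<omega> powr (-2 / \<alpha>) * weight y (\<xi> k \<omega>) \<le> b k * weight y (\<xi> k \<omega>)"
      unfolding b_def by (intro mult_right_mono mult_left_mono) (auto simp: weight_def)
    moreover have "(A k \<omega>)\<^sup>2 = (C_alpha \<alpha>)\<^sup>2 * arrival E k \<omega> powr (-2 / \<alpha>) * weight y (\<xi> k \<omega>)"
      using True unfolding A_def coef_def weight_def sq[symmetric] by (simp add: power_mult_distrib)
    ultimately show ?thesis by simp
  qed (auto simp: A_def b_def weight_def)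
  have A_sq: "integrable M (\<lambda>\<omega>. (A k \<omega>)\<^sup>2)" for k
    by (rule Bochner_Integration.integrable_bound[OF integrable_mult_right[OF weight_integral(1)[of y k], of "b k"]])
      (auto intro!: order_trans[OF A_le])
  have A_E: "expectation (\<lambda>\<omega>. (A k \<omega>)\<^sup>2) \<le> b k * (\<integral>z. \<phi> z * weight y z \<partial>lborel)" for k
    using integral_mono[OF A_sq integrable_mult_right[OF weight_integral(1)[of y k], of "b k"] A_le]
    by (simp add: weight_integral(2))
  have X_sq: "integrable M (\<lambda>\<omega>. (X k \<omega>)\<^sup>2)"
    "expectation (\<lambda>\<omega>. (X k \<omega>)\<^sup>2) = expectation (\<lambda>\<omega>. (A k \<omega>)\<^sup>2) * s\<^sup>2" for k
  proof -
    have "indep_var borel (\<lambda>\<omega>. (A k \<omega>)\<^sup>2) borel (\<lambda>\<omega>. (g k \<omega>)\<^sup>2)"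
      using indep_var_compose[OF indep_var_others[OF A_oth[of k k] measurable_ident], of "\<lambda>x. x\<^sup>2" borel "\<lambda>x. x\<^sup>2" borel]
      by (simp add: comp_def)
    from indep_var_integrable[OF this A_sq g_moments(3)] indep_var_lebesgue_integral[OF this A_sq g_moments(3)]
    show "integrable M (\<lambda>\<omega>. (X k \<omega>)\<^sup>2)"
      "expectation (\<lambda>\<omega>. (X k \<omega>)\<^sup>2) = expectation (\<lambda>\<omega>. (A k \<omega>)\<^sup>2) * s\<^sup>2"
      by (simp_all add: X_def power_mult_distrib g_moments(4))
  qed
  have "AE \<omega> in M. summable (\<lambda>k. X k \<omega>)"
  proof (rule AE_summable_of_orthogonal[where F=oth])
    show "subalgebra M (oth n)" for n by (rule subalgebra_others_algebra)
    show "X i \<in> borel_measurable (oth n)" if "i < n" for i n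
      unfolding X_def using A_oth measurable_others_g[of i n] that by (intro borel_measurable_times) auto
    show "X n \<in> borel_measurable M" for n unfolding X_def by measurable
    show "integrable M (\<lambda>\<omega>. (X n \<omega>)\<^sup>2)" for n by (rule X_sq)
    \<comment> \<open>\<open>A n\<close> and \<open>Z\<close> do not see \<open>g n\<close>, so the
      expectation factors and the centred \<open>g n\<close> makes it 0.\<close>
    show "expectation (\<lambda>\<omega>. X n \<omega> * Z \<omega>) = 0"
      if Z: "Z \<in> borel_measurable (oth n)" and c: "\<And>w. \<bar>Z w\<bar> \<le> c" for n Z c
    proof -
      have [measurable]: "Z \<in> borel_measurable M"
        by (rule measurable_from_subalg[OF subalgebra_others_algebra Z])
      have "integrable M (A n)" by (rule integrable_of_square_integrable[OF _ A_sq]) measurable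
      then have iAZ: "integrable M (\<lambda>\<omega>. A n \<omega> * Z \<omega>)"
      proof (rule Bochner_Integration.integrable_bound[OF integrable_mult_right[of c]])
        show "AE \<omega> in M. norm (A n \<omega> * Z \<omega>) \<le> norm (c * A n \<omega>)"
        proof (rule AE_I2)
          fix \<omega> show "norm (A n \<omega> * Z \<omega>) \<le> norm (c * A n \<omega>)"
            using mult_left_mono[OF c[of \<omega>], of "\<bar>A n \<omega>\<bar>"] c[of \<omega>] abs_ge_zero[of "Z \<omega>"]
            by (simp add: abs_mult mult.commute)
        qed
      qed measurable
      have "indep_var borel (\<lambda>\<omega>. A n \<omega> * Z \<omega>) borel (g n)"
        using indep_var_others[OF borel_measurable_times[OF A_oth[of n n] Z] measurable_ident] by simp
      from indep_var_lebesgue_integral[OF this iAZ g_moments(1)]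
      show ?thesis by (simp add: X_def g_moments(2) mult_ac)
    qed
    show "summable (\<lambda>n. expectation (\<lambda>\<omega>. (X n \<omega>)\<^sup>2))"
    proof (rule summable_comparison_test')
      have "- 2 / \<alpha> < -1" using \<alpha> by (simp add: field_simps)
      then have "summable (\<lambda>n. real n powr (-2 / \<alpha>))" by (simp add: summable_real_powr_iff)
      then have "summable (\<lambda>n. real (Suc n) powr (-2 / \<alpha>))" by (subst summable_Suc_iff)
      then have "summable (\<lambda>n. (C_alpha \<alpha>)\<^sup>2 * (real (Suc n) powr (-2 / \<alpha>) / 2 powr (-2 / \<alpha>)) *
          (\<integral>z. \<phi> z * weight y z \<partial>lborel) * s\<^sup>2)"
        by (intro summable_mult summable_mult2 summable_divide)
      then show "summable (\<lambda>n. b n * (\<integral>z. \<phi> z * weight y z \<partial>lborel) * s\<^sup>2)"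
        unfolding b_def by (simp only: powr_divide of_nat_0_le_iff zero_le_numeral)
      show "norm (expectation (\<lambda>\<omega>. (X n \<omega>)\<^sup>2)) \<le> b n * (\<integral>z. \<phi> z * weight y z \<partial>lborel) * s\<^sup>2" for n
        using A_E[of n] by (simp add: X_sq(2) mult_right_mono)
    qed
  qed
  with AE_arrival_linear show ?thesis
  proof eventually_elim
    case (elim \<omega>)
    have "eventually (\<lambda>k. X k \<omega> = lepage_term \<alpha> a \<sigma> \<phi> E \<xi> g y t \<omega> k) sequentially"
      using elim(1) by eventually_elim (simp add: X_def A_def lepage_term_eq)
    then show ?case using elim(2) by (simp add: summable_cong)
  qed
qed

text \<open>A variable with a density misses the point \<open>y\<close>, the only place where the
  kernel integral may diverge.\<close>

lemma AE_U_defined: "AE \<omega> in M. U_defined \<alpha> a \<sigma> \<phi> E \<xi> g y t \<omega>"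
proof -
  have "AE \<omega> in M. \<xi> k \<omega> \<noteq> y" for k
    by (subst distributed_AE2[OF \<xi>_dist]) (use AE_lborel_singleton[of y] in auto)
  then have "AE \<omega> in M. \<forall>k. \<xi> k \<omega> \<noteq> y" by (simp add: AE_all_countable)
  with AE_summable_lepage_term[of y] show ?thesis
    by eventually_elim (auto simp: U_defined_def G_finite)
qed

section \<open>Splitting off one Gaussian factor near a point of the ball\<close>

text \<open>Positivity of \<phi> makes the probability \<open>q\<close> of missing the ball less
  than 1, and by independence the first \<open>n + 1\<close> points all miss it with probability
  \<open>q ^ Suc n\<close>.\<close>

lemma AE_hit_ball:
  assumes r: "0 < r"
  shows "AE \<omega> in M. \<exists>k. \<xi> k \<omega> \<in> ball x r"
proof -
  let ?S = "\<lambda>k. \<xi> k -` (- ball x r) \<inter> space M"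
  have [measurable]: "ball x r \<in> sets borel" and meas: "- ball x r \<in> sets borel" by auto
  have S_eq: "emeasure M (?S k) = (\<integral>\<^sup>+ z. ennreal (\<phi> z) * indicator (- ball x r) z \<partial>lborel)" for k
    by (rule distributed_emeasure[OF \<xi>_dist]) auto
  define q where "q = prob (?S 0)"
  have q: "prob (?S k) = q" for k
    unfolding q_def measure_def S_eq ..
  have "q \<noteq> 1"
  proof
    assume "q = 1"
    then have "AE \<omega> in M. \<omega> \<in> ?S 0" unfolding q_def by (subst (asm) prob_eq_1) auto
    then have "AE \<omega> in M. \<xi> 0 \<omega> \<notin> ball x r" by eventually_elim auto
    then have "AE z in lborel. 0 < ennreal (\<phi> z) \<longrightarrow> z \<notin> ball x r"
      by (subst (asm) distributed_AE2[OF \<xi>_dist]) auto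
    then have "AE z in lborel. z \<notin> ball x r" using \<phi>_pos by simp
    then have "emeasure lborel (ball x r) = 0"
      by (subst (asm) AE_iff_measurable[of "ball x r"]) auto
    then show False using r by (simp add: emeasure_ball unit_ball_vol_2)
  qed
  then have q1: "q < 1" "0 \<le> q" using prob_le_1[of "?S 0"] unfolding q_def by (auto simp: less_le)
  let ?N = "{\<omega> \<in> space M. \<forall>k. \<xi> k \<omega> \<notin> ball x r}"
  have "prob ?N \<le> q ^ Suc n" for n
  proof -
    have "prob ?N \<le> prob (\<Inter>k\<in>{..n}. ?S k)"
      by (rule finite_measure_mono) auto
    also have "\<dots> = (\<Prod>k\<le>n. prob (?S k))"
      by (rule indep_varsD[OF indep_\<xi>]) (use meas in auto)
    finally show ?thesis by (simp add: q)
  qed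
  moreover have "(\<lambda>n. q ^ Suc n) \<longlonglongrightarrow> 0"
    using q1 by (intro LIMSEQ_Suc LIMSEQ_power_zero) auto
  ultimately have "prob ?N \<le> 0" by (intro LIMSEQ_le_const) auto
  then have "prob ?N = 0" using measure_nonneg[of M ?N] by linarith
  moreover have "?N \<in> events" by measurable
  ultimately have "AE \<omega> in M. \<not> (\<forall>k. \<xi> k \<omega> \<notin> ball x r)" by (subst (asm) prob_eq_0) auto
  then show ?thesis by simp
qed

text \<open>The term of index \<open>k\<close> is zeroed inside the series rather than subtracted
  afterwards, so that \<open>g k\<close> visibly does not occur and measurability in
  \<open>oth k\<close> follows.\<close>

definition remainder where
  "remainder k y \<omega> = (\<Sum>j. if j = k then 0 else lepage_term \<alpha> a \<sigma> \<phi> E \<xi> g y t \<omega> j)"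

lemma U_field_split:
  assumes "summable (lepage_term \<alpha> a \<sigma> \<phi> E \<xi> g y t \<omega>)"
  shows "U_field \<alpha> a \<sigma> \<phi> E \<xi> g y t \<omega> = coef k y \<omega> * g k \<omega> + remainder k y \<omega>"
proof -
  let ?f = "lepage_term \<alpha> a \<sigma> \<phi> E \<xi> g y t \<omega>"
  have 1: "(\<lambda>j. if j = k then ?f j else 0) sums ?f k" by (rule sums_single)
  have "(\<lambda>j. if j = k then 0 else ?f j) = (\<lambda>j. ?f j - (if j = k then ?f j else 0))" by auto
  then have "remainder k y \<omega> = suminf ?f - ?f k"
    unfolding remainder_def using sums_diff[OF summable_sums[OF assms] 1] by (simp add: sums_unique[symmetric])
  then show ?thesis by (simp add: U_field_def lepage_term_eq)
qed

lemma remainder_measurable: "remainder k y \<in> borel_measurable (oth k)"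
proof -
  have [measurable]: "coef j y \<in> borel_measurable (oth k)" for j
    by (rule coef_measurable) (rule measurable_others_E measurable_others_\<xi>)+
  have "(\<lambda>\<omega>. if j = k then 0 else coef j y \<omega> * g j \<omega>) \<in> borel_measurable (oth k)" for j
  proof (cases "j = k")
    case False
    then have [measurable]: "g j \<in> borel_measurable (oth k)" by (rule measurable_others_g)
    show ?thesis by simp
  qed simp
  then show ?thesis
    unfolding remainder_def[abs_def] lepage_term_eq by measurable
qed

text \<open>\<open>coef\<close> and \<open>remainder\<close> are measurable in \<open>oth k\<close>,
  hence independent of \<open>g k\<close>, whose normal law has no atoms.\<close>

lemma AE_unbounded_of_coef:
  fixes d :: "nat \<Rightarrow> real^2"
  shows "AE \<omega> in M. (\<forall>N::nat. \<exists>n. real N < \<bar>coef k (d n) \<omega>\<bar>) \<longrightarrow>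
     (\<forall>N::nat. \<exists>n. real N < \<bar>coef k (d n) \<omega> * g k \<omega> + remainder k (d n) \<omega>\<bar>)"
proof (rule AE_unbounded_perturbation[where T="\<lambda>n. coef k (d n)" and R="\<lambda>n. remainder k (d n)" and g="g k"])
  have [measurable]: "coef j y \<in> borel_measurable (oth k)" for j y
    by (rule coef_measurable) (rule measurable_others_E measurable_others_\<xi>)+
  show "indep_var (Pi\<^sub>M UNIV (\<lambda>_. borel)) (\<lambda>\<omega> n. (coef k (d n) \<omega>, remainder k (d n) \<omega>))
      (Pi\<^sub>M UNIV (\<lambda>_. borel)) (\<lambda>\<omega> n. (g k \<omega>, 0))"
    using remainder_measurable
    by (intro indep_var_others[where h="\<lambda>u n. (u, 0)"]) (auto intro!: measurable_abs_UNIV borel_measurable_Pair)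
  show "AE \<omega> in M. g k \<omega> \<noteq> c" for c
    by (subst distributed_AE2[OF g_dist]) (use AE_lborel_singleton[of c] in auto)
qed

lemma AE_unbounded:
  assumes x: "\<sigma> x t \<noteq> 0" and \<delta>: "0 < \<delta>"
  shows "AE \<omega> in M.
    (SUP y \<in> {y. dist y x \<le> \<delta> \<and> U_defined \<alpha> a \<sigma> \<phi> E \<xi> g y t \<omega>}.
       ereal \<bar>U_field \<alpha> a \<sigma> \<phi> E \<xi> g y t \<omega>\<bar>) = \<infinity>"
proof -
  obtain \<rho> where \<rho>: "0 < \<rho>"
    and blowup: "\<And>z N. dist z x < \<rho> \<Longrightarrow> \<exists>e>0. \<forall>y. 0 < dist y z \<longrightarrow> dist y z < e \<longrightarrow> N < \<bar>G_fun \<sigma> a y z t\<bar>"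
    using G_fun_blowup[OF x] by metis
  obtain D0 :: "(real^2) set" where D0: "countable D0" "\<And>X. open X \<Longrightarrow> X \<noteq> {} \<Longrightarrow> \<exists>d\<in>D0. d \<in> X"
    using countable_dense_setE by blast
  \<comment> \<open>Cutting with the ball keeps the points within the range of the supremum;
    countability lets the series converge at all of them simultaneously, almost surely.\<close>
  define D where "D = D0 \<inter> ball x \<delta>"
  have "D \<noteq> {}" using D0(2)[of "ball x \<delta>"] \<delta> by (auto simp: D_def)
  moreover have "countable D" using D0(1) by (auto simp: D_def)
  ultimately have d: "range (from_nat_into D) = D" by (rule range_from_nat_into)
  define d where "d = from_nat_into D"
  have "AE \<omega> in M. \<forall>n. U_defined \<alpha> a \<sigma> \<phi> E \<xi> g (d n) t \<omega>"
    using AE_U_defined by (simp add: AE_all_countable)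
  \<comment> \<open>Closeness \<open>\<rho>\<close> makes the kernel blow up at the point found;
    closeness \<open>\<delta>\<close> puts it inside the ball, so that \<open>D\<close> accumulates
    there.\<close>
  moreover have "AE \<omega> in M. \<exists>k. \<xi> k \<omega> \<in> ball x (min \<rho> \<delta>)"
    using \<rho> \<delta> by (intro AE_hit_ball) simp
  \<comment> \<open>All \<open>k\<close> are treated at once because the index selected below
    depends on \<open>\<omega>\<close>.\<close>
  moreover have "AE \<omega> in M. \<forall>k. (\<forall>N::nat. \<exists>n. real N < \<bar>coef k (d n) \<omega>\<bar>) \<longrightarrow>
     (\<forall>N::nat. \<exists>n. real N < \<bar>coef k (d n) \<omega> * g k \<omega> + remainder k (d n) \<omega>\<bar>)"
    using AE_unbounded_of_coef by (simp add: AE_all_countable)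
  ultimately show ?thesis using AE_arrival_pos
  proof eventually_elim
    case (elim \<omega>)
    obtain k where k: "dist (\<xi> k \<omega>) x < \<rho>" "dist (\<xi> k \<omega>) x < \<delta>"
      using elim(2) by (auto simp: dist_commute)
    let ?z = "\<xi> k \<omega>"
    let ?c = "C_alpha \<alpha> * arrival E k \<omega> powr (-1 / \<alpha>) * \<phi> ?z powr (-1 / \<alpha>)"
    have c: "0 < \<bar>?c\<bar>"
      using C_alpha_nonzero[OF \<alpha>] elim(4)[rule_format, of k] \<phi>_pos[of ?z] by auto
    have "\<exists>n. real N < \<bar>coef k (d n) \<omega>\<bar>" for N :: nat
    proof -
      obtain e where e: "0 < e"
        "\<And>y. 0 < dist y ?z \<Longrightarrow> dist y ?z < e \<Longrightarrow> real N / \<bar>?c\<bar> < \<bar>G_fun \<sigma> a y ?z t\<bar>"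
        using blowup[OF k(1), of "real N / \<bar>?c\<bar>"] by blast
      \<comment> \<open>\<open>?z\<close> is removed because the blow-up concerns only
        \<open>y\<close> different from \<open>?z\<close>; the open set stays nonempty since the
        plane has no isolated points.\<close>
      let ?X = "ball ?z e \<inter> ball x \<delta> - {?z}"
      have "?z islimpt UNIV" by (rule islimpt_UNIV)
      then have "?X \<noteq> {}"
        using k(2) e(1) by (auto simp: islimpt_def dist_commute dest!: spec[of _ "ball ?z e \<inter> ball x \<delta>"])
      then obtain y where y: "y \<in> D0" "y \<in> ?X" using D0(2)[of ?X] by auto
      then have "y \<in> D" by (auto simp: D_def)
      then obtain n where n: "d n = y" using d unfolding d_def by (metis rangeE)
      have "real N / \<bar>?c\<bar> < \<bar>G_fun \<sigma> a y ?z t\<bar>" using y by (intro e(2)) (auto simp: dist_commute)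
      then have "real N < \<bar>?c\<bar> * \<bar>G_fun \<sigma> a y ?z t\<bar>" using c by (simp add: pos_divide_less_eq mult.commute)
      then have "real N < \<bar>coef k (d n) \<omega>\<bar>" by (simp add: coef_def n abs_mult)
      then show ?thesis ..
    qed
    then have unb: "\<exists>n. real N < \<bar>coef k (d n) \<omega> * g k \<omega> + remainder k (d n) \<omega>\<bar>" for N :: nat
      using elim(3) by blast
    show ?case
    proof (rule SUP_PInfty)
      fix N :: nat
      obtain n where n: "real N < \<bar>coef k (d n) \<omega> * g k \<omega> + remainder k (d n) \<omega>\<bar>"
        using unb by blast
      have def: "U_defined \<alpha> a \<sigma> \<phi> E \<xi> g (d n) t \<omega>" using elim(1) by blast
      then have "U_field \<alpha> a \<sigma> \<phi> E \<xi> g (d n) t \<omega> = coef k (d n) \<omega> * g k \<omega> + remainder k (d n) \<omega>"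
        by (intro U_field_split) (simp add: U_defined_def)
      moreover have "d n \<in> D" using d by (auto simp: d_def)
      ultimately show "\<exists>y\<in>{y. dist y x \<le> \<delta> \<and> U_defined \<alpha> a \<sigma> \<phi> E \<xi> g y t \<omega>}.
          ereal (real N) \<le> ereal \<bar>U_field \<alpha> a \<sigma> \<phi> E \<xi> g y t \<omega>\<bar>"
        using n def by (intro bexI[of _ "d n"]) (auto simp: D_def dist_commute)
    qed
  qed
qed

end

text \<open>Restricting the supremum to points where \<open>U_defined\<close> holds keeps the
  arbitrary values assigned to divergent series and infinite kernels from contributing to
  it.\<close>

theorem theorem2:
  fixes M :: "'a measure" and \<alpha> a t \<delta> :: real
    and \<sigma> :: "real^2 \<Rightarrow> real \<Rightarrow> real" and \<phi> :: "real^2 \<Rightarrow> real"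
    and E g :: "nat \<Rightarrow> 'a \<Rightarrow> real" and \<xi> :: "nat \<Rightarrow> 'a \<Rightarrow> real^2" and x :: "real^2"
  assumes "prob_space M"
    and "0 < \<alpha>" "\<alpha> < 2" "0 < a"
    and "continuous_on (UNIV \<times> {0..}) (\<lambda>(y, \<tau>). \<sigma> y \<tau>)"
    and "\<exists>B. \<forall>y \<tau>. 0 \<le> \<tau> \<longrightarrow> \<bar>\<sigma> y \<tau>\<bar> \<le> B"
    and "continuous_on UNIV \<phi>" "\<forall>z. 0 < \<phi> z" "(\<integral>\<^sup>+ z. ennreal (\<phi> z) \<partial>lborel) = 1"
    and "\<forall>i. distributed M lborel (E i) (\<lambda>s. ennreal (exponential_density 1 s))"
    and "\<forall>k. distributed M lborel (\<xi> k) (\<lambda>z. ennreal (\<phi> z))"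
    and "\<exists>s>0. \<forall>k. distributed M lborel (g k) (\<lambda>r. ennreal (normal_density 0 s r))"
    and "\<forall>k. prob_space.expectation M (\<lambda>\<omega>. \<bar>g k \<omega>\<bar> powr \<alpha>) = 1"
    and "lepage_indep M E \<xi> g"
    and "0 < t" and "\<sigma> x t \<noteq> 0" and "0 < \<delta>"
  shows "AE \<omega> in M.
    (SUP y \<in> {y. dist y x \<le> \<delta> \<and> U_defined \<alpha> a \<sigma> \<phi> E \<xi> g y t \<omega>}.
       ereal \<bar>U_field \<alpha> a \<sigma> \<phi> E \<xi> g y t \<omega>\<bar>) = \<infinity>"
proof -
  obtain B where B: "\<And>y \<tau>. 0 \<le> \<tau> \<Longrightarrow> \<bar>\<sigma> y \<tau>\<bar> \<le> B" using assms(6) by blast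
  obtain s where s: "0 < s" "\<And>k. distributed M lborel (g k) (\<lambda>r. ennreal (normal_density 0 s r))"
    using assms(12) by blast
  interpret prob_space M by fact
  interpret lepage M E g \<xi> a t B \<sigma> \<alpha> s \<phi>
  proof unfold_locales
    show "E n \<in> borel_measurable M" "\<xi> n \<in> borel_measurable M" "g n \<in> borel_measurable M" for n
      using assms(10,11) s(2)[of n] by (auto dest!: distributed_measurable spec[of _ n])
  qed (use assms B s in auto)
  show ?thesis by (rule AE_unbounded) fact+
qed

end
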